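(* Let $p\geq 1$ and $n\geq 6$. Then for every tree $T$ of order $n$ with $T\not\cong S_{n}, S_{2,n-2}, S_{3,n-3}$, $$\rho(\mathbf{S}_{p}(T))<\rho(\mathbf{S}_{p}(S_{3,n-3}))<\rho(\mathbf{S}_{p}(S_{2,n-2}))<\rho(\mathbf{S}_{p}(S_{n})),$$ i.e. $S_{n}$, $S_{2,n-2}$, $S_{3,n-3}$ are, respectively, the unique trees of order $n$ with the first three maximum $p$-Sombor spectral radii.
   Context: All graphs are simple and connected; $d_i$ denotes the degree of vertex $v_i$. For $p\neq 0$, the $p$-Sombor matrix $\mathbf{S}_{p}(G)$ of a graph $G$ on $\{v_1,\dots,v_n\}$ has $(i,j)$-entry $(d_i^{p}+d_j^{p})^{1/p}$ if $v_iv_j\in E(G)$ and $0$ otherwise; $\rho(\mathbf{S}_{p}(G))$ denotes its largest eigenvalue. $S_n$ is the star of order $n$. For $2\leq d\leq\lfloor n/2\rfloor$, the double star $S_{d,n-d}$ is the tree of order $n$ consisting of two adjacent vertices $v_1,v_2$, where $v_1$ is adjacent to $d-1$ further pendant vertices and $v_2$ to $n-d-1$ further pendant vertices. *)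

theory Defs
  imports "HOL-Analysis.Analysis"
begin

text \<open>A graph on the (finite) vertex type 'n is given by its adjacency relation E.
  The order of the graph is CARD('n).\<close>

definition simple_graph :: "('n \<Rightarrow> 'n \<Rightarrow> bool) \<Rightarrow> bool" where
  "simple_graph E \<longleftrightarrow> (\<forall>u v. E u v \<longrightarrow> E v u) \<and> (\<forall>u. \<not> E u u)"

definition graph_edges :: "('n \<Rightarrow> 'n \<Rightarrow> bool) \<Rightarrow> 'n set set" where
  "graph_edges E = {{u, v} | u v. E u v}"

definition connected_graph :: "('n \<Rightarrow> 'n \<Rightarrow> bool) \<Rightarrow> bool" where
  "connected_graph E \<longleftrightarrow> (\<forall>u v. E\<^sup>*\<^sup>* u v)"

definition is_tree :: "('n::finite \<Rightarrow> 'n \<Rightarrow> bool) \<Rightarrow> bool" where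
  "is_tree E \<longleftrightarrow> simple_graph E \<and> connected_graph E \<and>
     card (graph_edges E) = CARD('n) - 1"

definition degree :: "('n::finite \<Rightarrow> 'n \<Rightarrow> bool) \<Rightarrow> 'n \<Rightarrow> nat" where
  "degree E v = card {u. E v u}"

definition is_star :: "('n \<Rightarrow> 'n \<Rightarrow> bool) \<Rightarrow> bool" where
  "is_star E \<longleftrightarrow> (\<exists>c. \<forall>u v. E u v \<longleftrightarrow> (u \<noteq> v \<and> (u = c \<or> v = c)))"

definition is_double_star :: "nat \<Rightarrow> ('n::finite \<Rightarrow> 'n \<Rightarrow> bool) \<Rightarrow> bool" where
  "is_double_star d E \<longleftrightarrow> (\<exists>a b L. a \<noteq> b \<and> L \<subseteq> UNIV - {a, b} \<and> card L = d - 1 \<and>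
     (\<forall>u v. E u v \<longleftrightarrow>
        ((u = a \<and> v = b) \<or> (u = b \<and> v = a) \<or>
         (u = a \<and> v \<in> L) \<or> (v = a \<and> u \<in> L) \<or>
         (u = b \<and> v \<notin> L \<union> {a, b}) \<or> (v = b \<and> u \<notin> L \<union> {a, b}))))"

definition sombor_matrix :: "real \<Rightarrow> ('n::finite \<Rightarrow> 'n \<Rightarrow> bool) \<Rightarrow> real^'n^'n" where
  "sombor_matrix p E = (\<chi> i j. if E i j
      then (real (degree E i) powr p + real (degree E j) powr p) powr (1 / p) else 0)"

text \<open>Largest eigenvalue of a real square matrix (the matrices considered are symmetric,
  so all their eigenvalues are real).\<close>
definition largest_eigenvalue :: "real^'n^'n \<Rightarrow> real" where
  "largest_eigenvalue A = Max {\<mu>. \<exists>v. v \<noteq> 0 \<and> A *v v = \<mu> *s v}"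

definition sombor_rho :: "real \<Rightarrow> ('n::finite \<Rightarrow> 'n \<Rightarrow> bool) \<Rightarrow> real" where
  "sombor_rho p E = largest_eigenvalue (sombor_matrix p E)"

end

theory Submission
  imports Defs
begin

text \<open>
  A tree is bipartite, so the square of its Sombor spectral radius is at most the sum of the squared
  edge weights (half the squared Frobenius norm); conversely it is at least the squared norm of any
  row. For \<open>S\<^sub>n\<close>, \<open>S\<^bsub>2,n-2\<^esub>\<close>, \<open>S\<^bsub>3,n-3\<^esub>\<close> these two
  bounds already separate the radii. The weights are \<open>p\<close>-norms of degree pairs; by Minkowski's
  inequality such a norm, relative to the coordinate sum, grows with the imbalance of the pair, which
  compares all weights with a few reference weights uniformly in \<open>p\<close>.

  For an arbitrary tree of maximum degree at most \<open>n - 4\<close>, root it at a vertex of maximum degree.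
  The excesses \<open>degree - 1\<close> of the other vertices sum up to the number of edges avoiding the root,
  and convexity bounds the sum of squared weights by that of a double star (or, for maximum degree 2
  or 3, directly), which is below \<open>\<rho>(S\<^bsub>3,n-3\<^esub>)\<^sup>2\<close>. Besides \<open>S\<^bsub>3,n-3\<^esub>\<close>
  itself, only two trees have maximum degree \<open>n - 3\<close>: two legs of length 2, or one leg of length 3,
  attached to a star. There, eliminating the eigenvector gives rational equations for
  \<open>\<rho>\<^sup>2\<close>, which have no root as large as \<open>\<rho>(S\<^bsub>3,n-3\<^esub>)\<^sup>2\<close>.
\<close>

subsection \<open>Spectral radius of symmetric matrices\<close>

lemma inner_symmetric_matrix:
  fixes A :: "real^'n^'n"
  assumes "transpose A = A"
  shows "inner x (A *v y) = inner (A *v x) y"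
  by (metis assms dot_lmul_matrix transpose_matrix_vector)

text \<open>Eigenvectors to distinct eigenvalues are orthogonal, so one choice per eigenvalue maps
  the spectrum injectively onto a finite orthogonal set. This is what makes the \<open>Max\<close>
  in \<open>largest_eigenvalue\<close> meaningful.\<close>

lemma finite_eigenvalues_symmetric:
  fixes A :: "real^'n^'n"
  assumes "transpose A = A"
  shows "finite {\<mu>. \<exists>v. v \<noteq> 0 \<and> A *v v = \<mu> *s v}" (is "finite ?S")
proof -
  obtain v where v: "\<And>\<mu>. \<mu> \<in> ?S \<Longrightarrow> v \<mu> \<noteq> 0 \<and> A *v v \<mu> = \<mu> *\<^sub>R v \<mu>"
    using bchoice[of ?S "\<lambda>\<mu> v. v \<noteq> 0 \<and> A *v v = \<mu> *\<^sub>R v"]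
    by (auto simp: scalar_mult_eq_scaleR)
  have orth: "inner (v a) (v b) = 0" if "a \<in> ?S" "b \<in> ?S" "a \<noteq> b" for a b
  proof -
    have "b * inner (v a) (v b) = a * inner (v a) (v b)"
      using inner_symmetric_matrix[OF assms, of "v a" "v b"] v[OF that(1)] v[OF that(2)] by simp
    then show ?thesis using that(3) by simp
  qed
  have "inj_on v ?S"
    using orth v by (metis (no_types, lifting) inj_onI inner_eq_zero_iff)
  moreover have "finite (v ` ?S)"
    by (rule pairwise_orthogonal_imp_finite)
      (auto simp: pairwise_def orthogonal_def intro!: orth)
  ultimately show ?thesis by (simp add: finite_image_iff)
qed

text \<open>A maximizer of the quadratic form on the compact unit sphere is an eigenvector, by the
  first-order condition for a maximum.\<close>

lemma rayleigh_maximizer_eigenvector: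
  fixes A :: "real^'n^'n"
  assumes sym: "transpose A = A"
  obtains v \<mu> where "v \<noteq> 0" "A *v v = \<mu> *s v"
    "\<And>x. inner x (A *v x) \<le> \<mu> * inner x x"
proof -
  have "continuous_on (sphere 0 1) (\<lambda>x. inner x (A *v x))"
    by (intro continuous_intros matrix_vector_mult_linear_continuous_on)
  moreover have "sphere (0::real^'n) 1 \<noteq> {}"
    by simp
  ultimately obtain v where v: "v \<in> sphere 0 1"
    and max: "\<And>y. y \<in> sphere 0 1 \<Longrightarrow> inner y (A *v y) \<le> inner v (A *v v)"
    using continuous_attains_sup[OF compact_sphere] by blast
  define \<mu> where "\<mu> = inner v (A *v v)"
  have R: "inner x (A *v x) \<le> \<mu> * inner x x" for x
  proof (cases "x = 0")
    case False
    define y where "y = x /\<^sub>R norm x"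
    have x: "x = norm x *\<^sub>R y" using False by (simp add: y_def)
    have "y \<in> sphere 0 1" using False by (simp add: y_def)
    then have le: "inner y (A *v y) \<le> \<mu>" unfolding \<mu>_def by (rule max)
    have "A *v x = norm x *\<^sub>R (A *v y)"
      by (subst x) (rule matrix_vector_mult_scaleR)
    then have "inner x (A *v x) = (norm x)^2 * inner y (A *v y)"
      by (metis inner_scaleR_left inner_scaleR_right mult.assoc power2_eq_square x)
    also have "\<dots> \<le> (norm x)^2 * \<mu>" by (intro mult_left_mono le) simp
    finally show ?thesis by (simp add: power2_norm_eq_inner mult.commute)
  qed simp
  have vv: "inner v v = 1" using v by (simp add: norm_eq_sqrt_inner)
  \<comment> \<open>The residual is also the direction of variation: moving from \<open>v\<close>
    along \<open>s\<close> times \<open>w\<close> gains \<open>2 * s * inner w w\<close> to first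
    order, up to a term quadratic in \<open>s\<close>.\<close>
  define w where "w = A *v v - \<mu> *\<^sub>R v"
  have q: "2 * s * inner w w \<le> s^2 * (\<mu> * inner w w - inner w (A *v w))" for s
  proof -
    have 1: "inner (v + s *\<^sub>R w) (A *v (v + s *\<^sub>R w)) \<le> \<mu> * inner (v + s *\<^sub>R w) (v + s *\<^sub>R w)"
      by (rule R)
    have 2: "inner (v + s *\<^sub>R w) (A *v (v + s *\<^sub>R w))
        = \<mu> + 2 * s * inner w (A *v v) + s^2 * inner w (A *v w)"
      using inner_symmetric_matrix[OF sym, of v w]
      by (simp add: matrix_vector_right_distrib matrix_vector_mult_scaleR inner_add \<mu>_def
          algebra_simps power2_eq_square inner_commute)
    have 3: "inner (v + s *\<^sub>R w) (v + s *\<^sub>R w) = 1 + 2 * s * inner w v + s^2 * inner w w"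
      by (simp add: inner_add vv algebra_simps power2_eq_square inner_commute)
    have 4: "inner w (A *v v) = inner w w + \<mu> * inner w v"
      unfolding w_def by (simp add: inner_diff algebra_simps inner_commute)
    show ?thesis using 1 unfolding 2 3 4 by (simp add: algebra_simps)
  qed
  have "w = 0"
  proof (rule ccontr)
    assume "w \<noteq> 0"
    then have pos: "inner w w > 0" by simp
    \<comment> \<open>A positive bound for the quadratic coefficient; with
      \<open>s = inner w w / c\<close> the linear gain wins unless \<open>w = 0\<close>.\<close>
    define c where "c = \<bar>\<mu> * inner w w - inner w (A *v w)\<bar> + 1"
    have c: "c > 0" "\<mu> * inner w w - inner w (A *v w) \<le> c" unfolding c_def by linarith+
    have "2 * (inner w w / c) * inner w w \<le> (inner w w / c)^2 * c"
      using q[of "inner w w / c"] mult_left_mono[OF c(2) zero_le_power2, of "inner w w / c"]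
      by linarith
    also have "\<dots> = (inner w w / c) * inner w w" using c by (simp add: power2_eq_square)
    finally have "(inner w w / c) * inner w w \<le> 0" by linarith
    moreover have "(inner w w / c) * inner w w > 0" using pos c by simp
    ultimately show False by linarith
  qed
  then have "A *v v = \<mu> *s v" by (simp add: w_def scalar_mult_eq_scaleR)
  moreover have "v \<noteq> 0" using vv by auto
  ultimately show thesis using R that by blast
qed

text \<open>Every eigenvalue is the Rayleigh quotient of its eigenvector, hence at most the Rayleigh
  maximum, which is itself an eigenvalue.\<close>

lemma largest_eigenvalue_symmetric:
  fixes A :: "real^'n^'n"
  assumes sym: "transpose A = A"
  obtains v where "v \<noteq> 0" "A *v v = largest_eigenvalue A *s v"
    "\<And>x. inner x (A *v x) \<le> largest_eigenvalue A * inner x x"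
proof -
  obtain v \<mu> where v: "v \<noteq> 0" "A *v v = \<mu> *s v"
    and R: "\<And>x. inner x (A *v x) \<le> \<mu> * inner x x"
    using rayleigh_maximizer_eigenvector[OF sym] by blast
  have "largest_eigenvalue A = \<mu>"
    unfolding largest_eigenvalue_def
  proof (rule Max_eqI[OF finite_eigenvalues_symmetric[OF sym]])
    fix \<nu> assume "\<nu> \<in> {\<mu>. \<exists>v. v \<noteq> 0 \<and> A *v v = \<mu> *s v}"
    then obtain y where y: "y \<noteq> 0" "A *v y = \<nu> *\<^sub>R y" by (auto simp: scalar_mult_eq_scaleR)
    then have "\<nu> * inner y y \<le> \<mu> * inner y y" using R[of y] by simp
    then show "\<nu> \<le> \<mu>" using y(1) by (simp add: mult_le_cancel_right)
  qed (use v in blast)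
  with v R that show thesis by blast
qed

text \<open>The test vector is \<open>r e + A e\<close> for the unit vector \<open>e\<close> at \<open>c\<close> and \<open>r\<close> the norm of its
  row.\<close>
lemma row_norm_le_largest_eigenvalue:
  fixes A :: "real^'n^'n"
  assumes sym: "transpose A = A" and nonneg: "\<And>i j. 0 \<le> A $ i $ j" and diag: "A $ c $ c = 0"
  shows "sqrt (\<Sum>j\<in>UNIV. (A $ c $ j)^2) \<le> largest_eigenvalue A"
proof -
  obtain v0 where v0: "v0 \<noteq> 0" "A *v v0 = largest_eigenvalue A *s v0"
    and R: "\<And>x. inner x (A *v x) \<le> largest_eigenvalue A * inner x x"
    using largest_eigenvalue_symmetric[OF sym] by blast
  define e where "e = (axis c 1 :: real^'n)"
  define w where "w = A *v e"
  define r where "r = sqrt (\<Sum>j\<in>UNIV. (A $ c $ j)^2)"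
  have Asym: "A $ i $ j = A $ j $ i" for i j
    using arg_cong[OF sym, of "\<lambda>M. M $ j $ i"] by (simp add: transpose_def)
  have r0: "r \<ge> 0" by (simp add: r_def sum_nonneg)
  have w: "w $ j = A $ c $ j" for j
    by (simp add: w_def e_def matrix_vector_mul_component axis_def inner_vec_def
        if_distrib[where f="\<lambda>x. _ * x"] Asym[of j] cong: if_cong)
  have ww: "inner w w = r^2"
    by (simp add: inner_vec_def w r_def sum_nonneg power2_eq_square)
  have ee: "inner e e = 1" by (simp add: e_def inner_axis)
  have ew: "inner e w = 0" by (simp add: e_def inner_axis' w diag)
  have eAw: "inner e (A *v w) = r^2"
    using inner_symmetric_matrix[OF sym, of e w] by (simp add: w_def[symmetric] ww)
  have wAw: "inner w (A *v w) \<ge> 0"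
    unfolding inner_vec_def matrix_vector_mult_def
    by (auto intro!: sum_nonneg mult_nonneg_nonneg nonneg simp: w)
  let ?x = "r *\<^sub>R e + w"
  have "inner ?x (A *v ?x) = r^2 * inner e w + r * inner e (A *v w) + r * inner w w + inner w (A *v w)"
    by (simp add: matrix_vector_right_distrib matrix_vector_mult_scaleR inner_add
        w_def[symmetric] algebra_simps power2_eq_square)
  then have "2 * r^3 \<le> inner ?x (A *v ?x)"
    using wAw by (simp add: ew eAw ww power2_eq_square power3_eq_cube)
  also have "\<dots> \<le> largest_eigenvalue A * inner ?x ?x" by (rule R)
  also have "inner ?x ?x = 2 * r^2"
    using ew by (simp add: inner_add ee ww power2_eq_square inner_commute)
  finally have *: "r * r^2 \<le> largest_eigenvalue A * r^2" by (simp add: power3_eq_cube power2_eq_square)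
  show ?thesis
  proof (cases "r = 0")
    case False
    then have "r^2 > 0" by simp
    with * have "r \<le> largest_eigenvalue A" by (simp add: mult_le_cancel_right)
    then show ?thesis by (simp add: r_def)
  next
    case True
    \<comment> \<open>For \<open>r = 0\<close> the test vector is zero; \<open>e\<close> itself has
      Rayleigh quotient 0 by the zero diagonal entry.\<close>
    have "inner e (A *v e) \<le> largest_eigenvalue A * inner e e" by (rule R)
    with True show ?thesis using ew by (simp add: w_def[symmetric] ee r_def)
  qed
qed

text \<open>Sorted by colour, the matrix consists of one off-diagonal block and its transpose, so
  the square of the eigenvalue is at most the squared Frobenius norm of that single block.\<close>

lemma bipartite_largest_eigenvalue_le:
  fixes A :: "real^'n^'n"
  assumes sym: "transpose A = A" and bip: "\<And>i j. A $ i $ j \<noteq> 0 \<Longrightarrow> s i \<noteq> (s j :: bool)"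
  shows "2 * (largest_eigenvalue A)^2 \<le> (\<Sum>i\<in>UNIV. \<Sum>j\<in>UNIV. (A $ i $ j)^2)"
proof -
  define \<rho> where "\<rho> = largest_eigenvalue A"
  obtain v where v: "v \<noteq> 0" "A *v v = \<rho> *s v"
    using largest_eigenvalue_symmetric[OF sym] unfolding \<rho>_def by blast
  have Asym: "A $ i $ j = A $ j $ i" for i j
    using arg_cong[OF sym, of "\<lambda>M. M $ j $ i"] by (simp add: transpose_def)
  define U where "U b = {i. s i = b}" for b
  define X where "X b = (\<Sum>i\<in>U b. (v $ i)^2)" for b
  define F where "F = (\<Sum>i\<in>U True. \<Sum>j\<in>U False. (A $ i $ j)^2)"
  have split: "(\<Sum>i\<in>UNIV. g i) = (\<Sum>i\<in>U True. g i) + (\<Sum>i\<in>U False. g i)" for g :: "'n \<Rightarrow> real"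
    by (subst sum.union_disjoint[symmetric]) (auto simp: U_def intro: sum.cong)
  have row: "(\<rho> * v $ i)^2 \<le> (\<Sum>j\<in>U (\<not> s i). (A $ i $ j)^2) * X (\<not> s i)" for i
  proof -
    have "\<rho> * v $ i = (\<Sum>j\<in>UNIV. A $ i $ j * v $ j)"
      using arg_cong[OF v(2), of "\<lambda>x. x $ i"] by (simp add: matrix_vector_mult_def)
    also have "\<dots> = (\<Sum>j\<in>U (\<not> s i). A $ i $ j * v $ j)"
      using bip by (intro sum.mono_neutral_right) (auto simp: U_def)
    finally show ?thesis
      using Cauchy_Schwarz_ineq_sum[of "\<lambda>j. A $ i $ j" "\<lambda>j. v $ j" "U (\<not> s i)"]
      by (simp add: X_def)
  qed
  \<comment> \<open>Cauchy-Schwarz bounds the mass \<open>X\<close> of each class by that of the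
    other. By symmetry both bounds carry the same factor \<open>F\<close>, so their sum can be
    divided by the squared norm of \<open>v\<close>.\<close>
  have 1: "\<rho>^2 * X b \<le> (\<Sum>i\<in>U b. \<Sum>j\<in>U (\<not> b). (A $ i $ j)^2) * X (\<not> b)" for b
  proof -
    have "\<rho>^2 * X b = (\<Sum>i\<in>U b. (\<rho> * v $ i)^2)"
      by (simp add: X_def sum_distrib_left power_mult_distrib)
    also have "\<dots> \<le> (\<Sum>i\<in>U b. (\<Sum>j\<in>U (\<not> b). (A $ i $ j)^2) * X (\<not> b))"
      using row by (intro sum_mono) (auto simp: U_def)
    finally show ?thesis by (simp only: sum_distrib_right)
  qed
  have F2: "(\<Sum>i\<in>U False. \<Sum>j\<in>U True. (A $ i $ j)^2) = F"
    unfolding F_def by (subst sum.swap) (simp add: Asym)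
  have "\<rho>^2 * (X True + X False) \<le> F * (X True + X False)"
    using 1[of True] 1[of False] F2 by (simp add: F_def distrib_left)
  moreover have "X True + X False > 0"
  proof -
    have "X True + X False = inner v v"
      by (simp add: X_def split[symmetric] inner_vec_def power2_eq_square)
    then show ?thesis using v(1) by simp
  qed
  ultimately have "\<rho>^2 \<le> F" by (simp add: mult_le_cancel_right)
  moreover have "2 * F \<le> (\<Sum>i\<in>UNIV. \<Sum>j\<in>UNIV. (A $ i $ j)^2)"
  proof -
    have "(\<Sum>i\<in>UNIV. \<Sum>j\<in>UNIV. (A $ i $ j)^2)
       = (\<Sum>i\<in>U True. \<Sum>j\<in>U True. (A $ i $ j)^2) + F + (F + (\<Sum>i\<in>U False. \<Sum>j\<in>U False. (A $ i $ j)^2))"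
      by (simp add: split sum.distrib F2 flip: F_def)
    moreover have "(\<Sum>i\<in>U b. \<Sum>j\<in>U b. (A $ i $ j)^2) \<ge> 0" for b
      by (intro sum_nonneg) auto
    from this[of True] this[of False] calculation show ?thesis by linarith
  qed
  ultimately show ?thesis by (simp add: \<rho>_def)
qed

subsection \<open>The two-dimensional p-norm\<close>

definition pnorm :: "real \<Rightarrow> real \<Rightarrow> real \<Rightarrow> real" where
  "pnorm p x y = (x powr p + y powr p) powr (1 / p)"

lemma pnorm_nonneg [simp]: "0 \<le> pnorm p x y"
  by (simp add: pnorm_def)

lemma pnorm_commute: "pnorm p x y = pnorm p y x"
  by (simp add: pnorm_def add.commute)

context
  fixes p :: real
  assumes p: "p \<ge> 1"
begin

lemma pnorm_pos: "x > 0 \<Longrightarrow> y > 0 \<Longrightarrow> pnorm p x y > 0"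
  by (simp add: pnorm_def add_pos_pos less_imp_neq[symmetric])

lemma pnorm_mono:
  assumes "0 \<le> x" "0 \<le> y" "x \<le> x'" "y \<le> y'"
  shows "pnorm p x y \<le> pnorm p x' y'"
  unfolding pnorm_def using p assms
  by (intro powr_mono2 add_mono) auto

lemma pnorm_scale:
  assumes "0 < c" "0 < x" "0 < y"
  shows "pnorm p (c * x) (c * y) = c * pnorm p x y"
proof -
  have "(c * x) powr p + (c * y) powr p = c powr p * (x powr p + y powr p)"
    using assms by (simp add: powr_mult distrib_left)
  then show ?thesis
    using assms p by (simp add: pnorm_def powr_mult powr_powr)
qed

lemma pnorm_powr:
  assumes "0 < x" "0 < y"
  shows "(pnorm p x y) powr p = x powr p + y powr p"
  using assms p by (simp add: pnorm_def powr_powr add_nonneg_nonneg)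

text \<open>The unit ball is convex because \<open>x powr p\<close> is a convex function.\<close>
lemma pnorm_triangle:
  assumes "0 < x" "0 < y" "0 < x'" "0 < y'"
  shows "pnorm p (x + x') (y + y') \<le> pnorm p x y + pnorm p x' y'"
proof -
  define a b where "a = pnorm p x y" and "b = pnorm p x' y'"
  have ab: "a > 0" "b > 0" using assms by (simp_all add: a_def b_def pnorm_pos)
  have conv: "((u + u') / (a + b)) powr p
      \<le> a / (a + b) * (u / a) powr p + b / (a + b) * (u' / b) powr p"
    if "u > 0" "u' > 0" for u u'
  proof -
    have "((1 - b/(a+b)) *\<^sub>R (u/a) + (b/(a+b)) *\<^sub>R (u'/b)) powr p
       \<le> (1 - b/(a+b)) * (u/a) powr p + (b/(a+b)) * (u'/b) powr p"
      using that ab by (intro convex_onD[OF powr_convex[OF p]]) (auto simp: field_simps)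
    moreover have "1 - b/(a+b) = a/(a+b)" using ab by (simp add: field_simps)
    moreover have "a/(a+b) * (u/a) + b/(a+b) * (u'/b) = (u + u')/(a+b)"
      using ab by (simp add: add_divide_distrib)
    ultimately show ?thesis by simp
  qed
  have unit: "(u / c) powr p + (w / c) powr p = 1" if "c = pnorm p u w" "u > 0" "w > 0" for u w c
  proof -
    have "u powr p + w powr p > 0" using that by (simp add: add_pos_pos)
    then show ?thesis
      using that pnorm_powr[OF that(2,3)] pnorm_pos[OF that(2,3)]
      by (simp add: powr_divide add_divide_distrib[symmetric])
  qed
  \<comment> \<open>The scaled sum is a convex combination of the two normalized pairs, with weights
    \<open>a / (a + b)\<close> and \<open>b / (a + b)\<close>.\<close>
  have "((x + x')/(a+b)) powr p + ((y+y')/(a+b)) powr p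
     \<le> a/(a+b) * ((x/a) powr p + (y/a) powr p) + b/(a+b) * ((x'/b) powr p + (y'/b) powr p)"
    using conv[of x x'] conv[of y y'] assms by (simp add: distrib_left)
  also have "\<dots> = 1"
    using unit[OF a_def assms(1,2)] unit[OF b_def assms(3,4)] ab
    by (simp add: add_divide_distrib[symmetric])
  finally have "pnorm p ((x + x')/(a+b)) ((y+y')/(a+b)) \<le> 1"
    unfolding pnorm_def using p powr_mono2[of "1/p" _ 1] by simp
  moreover have "pnorm p (x + x') (y + y') = (a + b) * pnorm p ((x + x')/(a+b)) ((y+y')/(a+b))"
    using pnorm_scale[of "a+b" "(x + x')/(a+b)" "(y+y')/(a+b)"] ab assms by simp
  ultimately show ?thesis
    using ab mult_left_mono[of _ 1 "a+b"] by (fastforce simp: a_def[symmetric] b_def[symmetric])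
qed

lemma pnorm_convex:
  assumes "0 < x" "0 < y" "0 < x'" "0 < y'" "0 \<le> \<theta>" "\<theta> \<le> 1"
  shows "pnorm p ((1-\<theta>) * x + \<theta> * x') ((1-\<theta>) * y + \<theta> * y') \<le> (1-\<theta>) * pnorm p x y + \<theta> * pnorm p x' y'"
proof (cases "\<theta> = 0 \<or> \<theta> = 1")
  case False
  then have "0 < \<theta>" "\<theta> < 1" using assms by auto
  then show ?thesis
    using pnorm_triangle[of "(1-\<theta>) * x" "(1-\<theta>) * y" "\<theta> * x'" "\<theta> * y'"] assms
    by (simp add: pnorm_scale)
qed auto

text \<open>Schur convexity: the pair \<open>(x, y) / c\<close> is weakly majorized by \<open>(X, Y)\<close>.\<close>
lemma pnorm_majorize:
  assumes "0 < x" "0 < y" "0 < X" "0 < Y" "0 < c"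
    and "x + y \<le> c * (X + Y)" "x \<le> c * X" "y \<le> c * X" "Y \<le> X"
  shows "pnorm p x y \<le> c * pnorm p X Y"
proof -
  have *: "pnorm p u w \<le> pnorm p X Y" if "0 < u" "0 < w" "u + w \<le> X + Y" "u \<le> X" "w \<le> u" for u w
  proof (cases "w \<le> Y")
    case True
    then show ?thesis using that assms by (intro pnorm_mono) auto
  next
    case False
    \<comment> \<open>Raising the first coordinate to \<open>v\<close> restores the sum
      \<open>X + Y\<close>. Then \<open>(v, w)\<close> lies on the segment from
      \<open>(X, Y)\<close> to \<open>(Y, X)\<close>, whose endpoints have equal norm, and convexity
      applies.\<close>
    define v where "v = X + Y - w"
    have le: "pnorm p u w \<le> pnorm p v w"
      using that by (intro pnorm_mono) (auto simp: v_def)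
    have XY: "X - Y > 0" using False that by simp
    define \<theta> where "\<theta> = (w - Y) / (X - Y)"
    have t: "0 \<le> \<theta>" "\<theta> \<le> 1" "\<theta> * (X - Y) = w - Y" using XY False that by (auto simp: \<theta>_def)
    have e: "(1-\<theta>) * X + \<theta> * Y = v" "(1-\<theta>) * Y + \<theta> * X = w"
      using t(3) by (simp_all add: algebra_simps v_def)
    have "pnorm p v w \<le> (1-\<theta>) * pnorm p X Y + \<theta> * pnorm p Y X"
      using pnorm_convex[of X Y Y X \<theta>] assms t unfolding e by simp
    also have "\<dots> = pnorm p X Y" by (simp add: pnorm_commute[of p Y X] algebra_simps)
    finally show ?thesis using le by simp
  qed
  have "pnorm p (x/c) (y/c) \<le> pnorm p X Y"
  proof (cases "y \<le> x")
    case True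
    then show ?thesis using assms by (intro *) (auto simp: field_simps)
  next
    case False
    then show ?thesis using assms
      by (subst pnorm_commute, intro *) (auto simp: field_simps)
  qed
  then show ?thesis
    using pnorm_scale[of c "x/c" "y/c"] assms by simp
qed

text \<open>A nonnegative convex function has a convex square. With one degree fixed, squared
  weights can thus be interpolated linearly in the other.\<close>

lemma pnorm_sq_convex:
  assumes "0 < x" "0 < y" "0 < z" "0 \<le> \<theta>" "\<theta> \<le> 1"
  shows "(pnorm p x (y + \<theta> * (z - y)))^2 \<le> (pnorm p x y)^2 + \<theta> * ((pnorm p x z)^2 - (pnorm p x y)^2)"
proof -
  define a b where "a = pnorm p x y" and "b = pnorm p x z"
  have "pnorm p x (y + \<theta> * (z - y)) \<le> (1-\<theta>) * a + \<theta> * b"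
    using pnorm_convex[of x y x z \<theta>] assms by (simp add: a_def b_def algebra_simps)
  then have "(pnorm p x (y + \<theta> * (z - y)))^2 \<le> ((1-\<theta>) * a + \<theta> * b)^2"
    by (intro power_mono) auto
  also have "\<dots> = a^2 + \<theta> * (b^2 - a^2) - \<theta> * (1-\<theta>) * (a - b)^2"
    by (simp add: power2_eq_square algebra_simps)
  also have "\<dots> \<le> a^2 + \<theta> * (b^2 - a^2)" using assms by simp
  finally show ?thesis by (simp add: a_def b_def)
qed

end

subsection \<open>Sombor matrices of trees\<close>

definition sombor_weight :: "real \<Rightarrow> ('n::finite \<Rightarrow> 'n \<Rightarrow> bool) \<Rightarrow> 'n \<Rightarrow> 'n \<Rightarrow> real" where
  "sombor_weight p E i j = pnorm p (real (degree E i)) (real (degree E j))"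

lemma sombor_weight_commute: "sombor_weight p E i j = sombor_weight p E j i"
  by (simp add: sombor_weight_def pnorm_commute)

lemma sombor_matrix_nth: "sombor_matrix p E $ i $ j = (if E i j then sombor_weight p E i j else 0)"
  by (simp add: sombor_matrix_def sombor_weight_def pnorm_def)

lemma transpose_sombor_matrix:
  assumes "simple_graph E"
  shows "transpose (sombor_matrix p E) = sombor_matrix p E"
  using assms by (auto simp: vec_eq_iff transpose_def sombor_matrix_nth sombor_weight_commute simple_graph_def)

lemma sombor_rho_eigenvector:
  fixes E :: "'n::finite \<Rightarrow> 'n \<Rightarrow> bool"
  assumes "simple_graph E"
  obtains y :: "'n \<Rightarrow> real" where "\<exists>i. y i \<noteq> 0"
    "\<And>i. sombor_rho p E * y i = (\<Sum>j | E i j. sombor_weight p E i j * y j)"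
proof -
  obtain v :: "real^'n" where v: "v \<noteq> 0" "sombor_matrix p E *v v = sombor_rho p E *s v"
    using largest_eigenvalue_symmetric[OF transpose_sombor_matrix[OF assms]]
    unfolding sombor_rho_def by blast
  have "sombor_rho p E * v $ i = (\<Sum>j | E i j. sombor_weight p E i j * v $ j)" for i
  proof -
    have "sombor_rho p E * v $ i = (\<Sum>j\<in>UNIV. sombor_matrix p E $ i $ j * v $ j)"
      using arg_cong[OF v(2), of "\<lambda>x. x $ i"] by (simp add: matrix_vector_mult_def)
    also have "\<dots> = (\<Sum>j\<in>UNIV. if E i j then sombor_weight p E i j * v $ j else 0)"
      by (intro sum.cong) (auto simp: sombor_matrix_nth)
    finally show ?thesis by (simp add: sum.If_cases)
  qed
  moreover have "\<exists>i. v $ i \<noteq> 0" using v(1) by (auto simp: vec_eq_iff)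
  ultimately show thesis using that[of "\<lambda>i. v $ i"] by blast
qed

lemma sum_sombor_matrix_row:
  "(\<Sum>j\<in>UNIV. (sombor_matrix p E $ i $ j)^2) = (\<Sum>j | E i j. (sombor_weight p E i j)^2)"
proof -
  have "(\<Sum>j\<in>UNIV. (sombor_matrix p E $ i $ j)^2)
      = (\<Sum>j\<in>UNIV. if E i j then (sombor_weight p E i j)^2 else 0)"
    by (intro sum.cong) (auto simp: sombor_matrix_nth)
  then show ?thesis by (simp add: sum.If_cases)
qed

lemma sombor_rho_ge_row:
  assumes "simple_graph E"
  shows "0 \<le> sombor_rho p E" "(\<Sum>j | E c j. (sombor_weight p E c j)^2) \<le> (sombor_rho p E)^2"
proof -
  have "sqrt (\<Sum>j\<in>UNIV. (sombor_matrix p E $ c $ j)^2) \<le> sombor_rho p E"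
    unfolding sombor_rho_def
    using assms by (intro row_norm_le_largest_eigenvalue transpose_sombor_matrix)
      (auto simp: sombor_matrix_nth sombor_weight_def simple_graph_def)
  then have 1: "sqrt (\<Sum>j | E c j. (sombor_weight p E c j)^2) \<le> sombor_rho p E"
    by (simp add: sum_sombor_matrix_row)
  have 2: "0 \<le> (\<Sum>j | E c j. (sombor_weight p E c j)^2)" by (simp add: sum_nonneg)
  show 3: "0 \<le> sombor_rho p E" using 1 2 real_sqrt_ge_zero order_trans by blast
  show "(\<Sum>j | E c j. (sombor_weight p E c j)^2) \<le> (sombor_rho p E)^2"
    using 1 3 by (rule_tac sqrt_le_D)
qed

lemma sombor_rho_le_bipartite:
  fixes s :: "'n::finite \<Rightarrow> bool"
  assumes "simple_graph E" "\<And>i j. E i j \<Longrightarrow> s i \<noteq> s j"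
  shows "2 * (sombor_rho p E)^2 \<le> (\<Sum>i\<in>UNIV. \<Sum>j | E i j. (sombor_weight p E i j)^2)"
proof -
  have "sombor_matrix p E $ i $ j \<noteq> 0 \<Longrightarrow> s i \<noteq> s j" for i j
    using assms(2) by (simp add: sombor_matrix_nth split: if_splits)
  from bipartite_largest_eigenvalue_le[OF transpose_sombor_matrix[OF assms(1)] this]
  show ?thesis by (simp only: sum_sombor_matrix_row sombor_rho_def)
qed

section \<open>Rooted trees and sums over their edges\<close>

lemma card_Compl_singleton: "card (- {x :: 'n::finite}) = CARD('n) - 1"
  by (simp add: Compl_eq_Diff_UNIV)

text \<open>Each edge is represented exactly once, by its endpoint farther from the root;
  \<open>dep\<close> rules out that two vertices are parents of each other.\<close>

locale rooted_tree =
  fixes E :: "'n::finite \<Rightarrow> 'n \<Rightarrow> bool" and r :: 'n and par :: "'n \<Rightarrow> 'n" and dep :: "'n \<Rightarrow> nat"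
  assumes edge_iff: "E x y \<longleftrightarrow> x \<noteq> r \<and> y = par x \<or> y \<noteq> r \<and> x = par y"
    and dep_par: "x \<noteq> r \<Longrightarrow> dep x = Suc (dep (par x))"

text \<open>Depth is the distance from \<open>r\<close>, and a parent is any neighbour one step
  closer. The parent edges are as many as the tree has edges, so there are no others.\<close>

lemma tree_obtain_root:
  fixes E :: "'n::finite \<Rightarrow> 'n \<Rightarrow> bool"
  assumes "is_tree E"
  obtains par dep where "rooted_tree E r par dep"
proof -
  have sym: "E x y \<Longrightarrow> E y x" and irr: "\<not> E x x" and conn: "E\<^sup>*\<^sup>* x y"
    and card: "card (graph_edges E) = CARD('n) - 1" for x y
    using assms by (auto simp: is_tree_def simple_graph_def connected_graph_def)
  define dep where "dep x = (LEAST n. (E ^^ n) r x)" for x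
  have dep: "(E ^^ dep x) r x" for x
  proof -
    obtain n where "(E ^^ n) r x" using conn[of r x] by (auto simp: rtranclp_power)
    then show ?thesis unfolding dep_def by (rule LeastI)
  qed
  have dep_le: "dep x \<le> n" if "(E ^^ n) r x" for x n
    unfolding dep_def using that by (rule Least_le)
  have "\<exists>y. E x y \<and> dep x = Suc (dep y)" if xr: "x \<noteq> r" for x
  proof -
    obtain m where m: "dep x = Suc m"
      using dep[of x] xr by (cases "dep x") auto
    then obtain y where y: "(E ^^ m) r y" "E y x" using dep[of x] by auto
    have "dep y \<le> m" using y(1) by (rule dep_le)
    moreover have "(E ^^ Suc (dep y)) r x" using dep[of y] y(2) by auto
    then have "dep x \<le> Suc (dep y)" by (rule dep_le)
    ultimately show ?thesis using m sym[OF y(2)] by (intro exI[of _ y]) simp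
  qed
  then obtain par where par: "\<And>x. x \<noteq> r \<Longrightarrow> E x (par x) \<and> dep x = Suc (dep (par x))"
    by metis
  have inj: "inj_on (\<lambda>x. {x, par x}) (- {r})"
  proof (rule inj_onI)
    fix x y assume xy: "x \<in> - {r}" "y \<in> - {r}" and eq: "{x, par x} = {y, par y}"
    show "x = y"
    proof (rule ccontr)
      assume "x \<noteq> y"
      then have "x = par y" "y = par x" using eq by (auto simp: doubleton_eq_iff)
      then show False using par[of x] par[of y] xy by simp
    qed
  qed
  have sub: "(\<lambda>x. {x, par x}) ` (- {r}) \<subseteq> graph_edges E"
    using par by (auto simp: graph_edges_def)
  have "card ((\<lambda>x. {x, par x}) ` (- {r})) = card (graph_edges E)"
    by (simp add: card_image[OF inj] card card_Compl_singleton)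
  then have eq: "(\<lambda>x. {x, par x}) ` (- {r}) = graph_edges E"
    using sub by (intro card_subset_eq) auto
  have "rooted_tree E r par dep"
  proof
    fix x y
    show "E x y \<longleftrightarrow> x \<noteq> r \<and> y = par x \<or> y \<noteq> r \<and> x = par y"
    proof
      assume "E x y"
      then have "{x, y} \<in> (\<lambda>x. {x, par x}) ` (- {r})"
        unfolding eq by (auto simp: graph_edges_def)
      then show "x \<noteq> r \<and> y = par x \<or> y \<noteq> r \<and> x = par y"
        by (auto simp: doubleton_eq_iff)
    qed (use par sym in blast)
  qed (use par in blast)
  then show thesis by (rule that)
qed

context rooted_tree
begin

lemma par_neq: "x \<noteq> r \<Longrightarrow> par x \<noteq> x"
  using dep_par[of x] by auto

lemma simple: "simple_graph E"
  unfolding simple_graph_def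
proof (intro conjI allI impI)
  show "E v u" if "E u v" for u v using that unfolding edge_iff by blast
  show "\<not> E u u" for u using par_neq[of u] unfolding edge_iff by auto
qed

text \<open>Ordered adjacent pairs are either upward, \<open>(v, par v)\<close>, or downward,
  \<open>(par v, v)\<close>; depth shows that no pair is both.\<close>

lemma sum_edges:
  fixes g :: "'n \<Rightarrow> 'n \<Rightarrow> 'a::comm_monoid_add"
  shows "(\<Sum>i\<in>UNIV. \<Sum>j | E i j. g i j) = (\<Sum>v\<in>-{r}. g v (par v)) + (\<Sum>v\<in>-{r}. g (par v) v)"
proof -
  let ?A = "(\<lambda>v. (v, par v)) ` (-{r})" and ?B = "(\<lambda>v. (par v, v)) ` (-{r})"
  have "(\<Sum>i\<in>UNIV. \<Sum>j | E i j. g i j) = (\<Sum>(i,j)\<in>(SIGMA i:UNIV. {j. E i j}). g i j)"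
    by (rule sum.Sigma) auto
  also have "(SIGMA i:UNIV. {j. E i j}) = ?A \<union> ?B"
    by (auto simp: edge_iff)
  also have "(\<Sum>(i,j)\<in>?A \<union> ?B. g i j) = (\<Sum>(i,j)\<in>?A. g i j) + (\<Sum>(i,j)\<in>?B. g i j)"
  proof (intro sum.union_disjoint)
    show "?A \<inter> ?B = {}"
    proof (rule equals0I)
      fix e assume "e \<in> ?A \<inter> ?B"
      then obtain u v where uv: "u \<noteq> r" "v \<noteq> r" and e: "e = (u, par u)" "e = (par v, v)"
        by blast
      have eq: "(u, par u) = (par v, v)" using e by (rule subst)
      have "dep (par u) = dep v" "dep u = dep (par v)"
        by (rule Pair_inject[OF eq], rule arg_cong, assumption)+
      then show False using dep_par[OF uv(1)] dep_par[OF uv(2)] by linarith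
    qed
  qed auto
  also have "\<dots> = (\<Sum>v\<in>-{r}. g v (par v)) + (\<Sum>v\<in>-{r}. g (par v) v)"
    by (simp add: sum.reindex inj_on_def)
  finally show ?thesis .
qed

lemma sum_degree: "(\<Sum>v\<in>UNIV. degree E v) = 2 * (CARD('n) - 1)"
  using sum_edges[of "\<lambda>_ _. 1::nat"] by (simp add: degree_def card_Compl_singleton)

text \<open>The parity of the depth is a proper 2-colouring, and the double sum of the bipartite
  bound counts each edge twice.\<close>

lemma sombor_rho_le_sum:
  "(sombor_rho p E)^2 \<le> (\<Sum>v\<in>-{r}. (sombor_weight p E v (par v))^2)"
proof -
  have "even (dep i) \<noteq> even (dep j)" if "E i j" for i j
    using that[unfolded edge_iff] dep_par[of i] dep_par[of j] by (metis even_Suc)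
  from sombor_rho_le_bipartite[OF simple this]
  have "2 * (sombor_rho p E)^2 \<le> (\<Sum>i\<in>UNIV. \<Sum>j | E i j. (sombor_weight p E i j)^2)" .
  also have "\<dots> = (\<Sum>v\<in>-{r}. (sombor_weight p E v (par v))^2) + (\<Sum>v\<in>-{r}. (sombor_weight p E v (par v))^2)"
    unfolding sum_edges using sombor_weight_commute[of p E] by (intro arg_cong2[of _ _ _ _ "(+)"] sum.cong) auto
  finally show ?thesis by simp
qed

lemma degree_pos:
  assumes "CARD('n) \<ge> 2"
  shows "degree E v \<ge> 1"
proof -
  have "\<exists>u. E v u"
  proof (cases "v = r")
    case True
    have "card (-{r}) \<noteq> 0" using assms by (simp add: card_Compl_singleton)
    then have "-{r} \<noteq> {}" by (metis card.empty)
    then have "\<exists>x. x \<noteq> r" by blast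
    \<comment> \<open>A non-root vertex of least depth must have the root as its parent.\<close>
    then obtain x where x: "x \<noteq> r" "\<And>y. y \<noteq> r \<Longrightarrow> dep x \<le> dep y"
      using ex_has_least_nat[of "\<lambda>x. x \<noteq> r" _ dep] by blast
    then have "par x = r" using dep_par[of x] x(2)[of "par x"] by fastforce
    then show ?thesis using x True by (auto simp: edge_iff)
  qed (auto simp: edge_iff)
  then show ?thesis by (auto simp: degree_def Suc_le_eq card_gt_0_iff)
qed

lemma degree_root_less: "degree E r \<le> CARD('n) - 1"
proof -
  have "{u. E r u} \<subseteq> -{r}" using simple by (auto simp: simple_graph_def)
  then have "card {u. E r u} \<le> card (-{r})" by (intro card_mono) auto
  then show ?thesis by (simp add: degree_def card_Compl_singleton)
qed

text \<open>The handshake identity. The right-hand side is the number of edges avoiding the root,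
  the budget that the convexity arguments below distribute over the other vertices.\<close>

lemma sum_excess:
  assumes "CARD('n) \<ge> 2"
  shows "(\<Sum>v\<in>-{r}. real (degree E v) - 1) = real (CARD('n) - 1 - degree E r)"
proof -
  have "real (\<Sum>v\<in>UNIV. degree E v) = real (degree E r) + (\<Sum>v\<in>-{r}. real (degree E v))"
    by (simp add: sum.remove[of UNIV r] Compl_eq_Diff_UNIV)
  then have "(\<Sum>v\<in>-{r}. real (degree E v)) = 2 * real (CARD('n) - 1) - real (degree E r)"
    by (simp add: sum_degree)
  then show ?thesis
    using degree_root_less assms by (simp add: sum_subtractf card_Compl_singleton of_nat_diff)
qed

text \<open>The right-hand side is the sum of squared edge weights of a double star with centres of
  degrees \<open>D\<close> and \<open>R + 1\<close>.\<close>
lemma sombor_rho_le_double_star: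
  assumes p: "p \<ge> 1" and n: "CARD('n) \<ge> 2" and R: "R = CARD('n) - 1 - degree E r" "R \<ge> 1"
  defines "D \<equiv> degree E r"
  shows "(sombor_rho p E)^2 \<le> (real D - 1) * (pnorm p (real D) 1)^2
     + (pnorm p (real D) (real R + 1))^2 + real R * (pnorm p (real R + 1) 1)^2"
proof -
  define d where "d v = real (degree E v)" for v
  define N where "N = {v. E r v}"
  have d1: "d v \<ge> 1" for v using degree_pos[OF n, of v] by (simp add: d_def)
  have dr: "d r = real D" by (simp add: d_def D_def)
  have N: "N \<subseteq> -{r}" "card N = D" "\<And>v. v \<in> N \<Longrightarrow> par v = r"
    using simple by (auto simp: N_def D_def degree_def simple_graph_def edge_iff)
  have sum_all: "(\<Sum>v\<in>-{r}. d v - 1) = real R" using sum_excess[OF n] R by (simp add: d_def)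
  have sum_sub: "(\<Sum>v\<in>S. d v - 1) \<le> real R" if "S \<subseteq> -{r}" for S
    using sum_mono2[of "-{r}" S "\<lambda>v. d v - 1"] that d1 sum_all by (simp add: finite_subset)
  have w: "sombor_weight p E v (par v) = pnorm p (d (par v)) (d v)" for v
    by (subst sombor_weight_commute) (simp add: sombor_weight_def d_def)
  define a b where "a = (pnorm p (real D) 1)^2" and "b = (pnorm p (real D) (real R + 1))^2"
  have ab: "a \<le> b" unfolding a_def b_def using R by (intro power_mono pnorm_mono p) auto
  have R0: "real R > 0" using R by simp
  \<comment> \<open>Edges at the root: interpolation between leaf (\<open>a\<close>) and a vertex
    carrying the whole excess (\<open>b\<close>). Since all excesses together are at most
    \<open>R\<close>, the sum over \<open>N\<close> pays for at most one full difference
    \<open>b - a\<close>.\<close>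
  have 1: "(sombor_weight p E v (par v))^2 \<le> a + (d v - 1) / real R * (b - a)" if "v \<in> N" for v
  proof -
    have wv: "sombor_weight p E v (par v) = pnorm p (real D) (d v)"
      using w[of v] N(3)[OF that] dr by simp
    have "d v - 1 \<le> real R" using sum_sub[of "{v}"] that N by auto
    then show ?thesis
      using pnorm_sq_convex[OF p, of "real D" 1 "real R + 1" "(d v - 1) / real R"] d1[of v] d1[of r, unfolded dr] R0
      unfolding wv a_def b_def by simp
  qed
  have "(\<Sum>v\<in>N. (sombor_weight p E v (par v))^2) \<le> (\<Sum>v\<in>N. a + (d v - 1) / real R * (b - a))"
    by (intro sum_mono 1)
  also have "\<dots> = real D * a + (\<Sum>v\<in>N. d v - 1) / real R * (b - a)"
    by (simp add: sum.distrib N(2) sum_distrib_right sum_divide_distrib)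
  also have "\<dots> \<le> real D * a + 1 * (b - a)"
    using sum_sub[OF N(1)] R0 ab by (intro add_left_mono mult_right_mono) auto
  finally have A: "(\<Sum>v\<in>N. (sombor_weight p E v (par v))^2) \<le> (real D - 1) * a + b"
    by (simp add: algebra_simps)
  \<comment> \<open>Edges avoiding the root: the two endpoints share the excess \<open>R\<close>, so
    their degree pair is majorized by \<open>(R + 1, 1)\<close>.\<close>
  have 2: "(sombor_weight p E v (par v))^2 \<le> (pnorm p (real R + 1) 1)^2" if "v \<in> -{r} - N" for v
  proof -
    have pv: "par v \<noteq> r" "v \<noteq> r" "par v \<noteq> v" using that par_neq[of v] by (auto simp: N_def edge_iff)
    then have "d v + d (par v) \<le> real R + 2" using sum_sub[of "{v, par v}"] by auto
    then have "pnorm p (d (par v)) (d v) \<le> 1 * pnorm p (real R + 1) 1"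
      using d1[of v] d1[of "par v"] by (intro pnorm_majorize[OF p]) auto
    then show ?thesis unfolding w by (intro power_mono) auto
  qed
  have "card (-{r} - N) = R"
    using N R by (simp add: card_Diff_subset card_Compl_singleton finite_subset D_def)
  then have B: "(\<Sum>v\<in>-{r} - N. (sombor_weight p E v (par v))^2) \<le> real R * (pnorm p (real R + 1) 1)^2"
    using sum_bounded_above[of "-{r} - N", OF 2] by simp
  have "(\<Sum>v\<in>-{r}. (sombor_weight p E v (par v))^2)
     = (\<Sum>v\<in>-{r} - N. (sombor_weight p E v (par v))^2) + (\<Sum>v\<in>N. (sombor_weight p E v (par v))^2)"
    by (rule sum.subset_diff) (use N in auto)
  then show ?thesis using sombor_rho_le_sum[of p] A B by (simp add: a_def b_def)
qed

text \<open>Replacing the parent's degree by the maximum \<open>D\<close> and interpolating the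
  child's degree between 1 and \<open>D\<close> makes the bound linear in the excesses, whose sum is
  known.\<close>

lemma sombor_rho_le_max_degree:
  assumes p: "p \<ge> 1" and n: "CARD('n) \<ge> 2" and D: "D = degree E r" "D \<ge> 2"
    and max: "\<And>v. degree E v \<le> D"
  shows "(sombor_rho p E)^2 \<le> real (CARD('n) - 1) * (pnorm p (real D) 1)^2
     + real (CARD('n) - 1 - D) / (real D - 1) * ((pnorm p (real D) (real D))^2 - (pnorm p (real D) 1)^2)"
proof -
  define d where "d v = real (degree E v)" for v
  have d1: "d v \<ge> 1" for v using degree_pos[OF n, of v] by (simp add: d_def)
  have dD: "d v \<le> real D" for v using max[of v] by (simp add: d_def)
  define a b where "a = (pnorm p (real D) 1)^2" and "b = (pnorm p (real D) (real D))^2"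
  have "(sombor_weight p E v (par v))^2 \<le> a + (d v - 1) / (real D - 1) * (b - a)" for v
  proof -
    have "sombor_weight p E v (par v) \<le> pnorm p (real D) (d v)"
      using d1[of v] d1[of "par v"] dD
      by (subst sombor_weight_commute) (auto simp: sombor_weight_def d_def intro!: pnorm_mono p max)
    then have "(sombor_weight p E v (par v))^2 \<le> (pnorm p (real D) (d v))^2"
      by (intro power_mono) (auto simp: sombor_weight_def)
    also have "\<dots> \<le> a + (d v - 1) / (real D - 1) * (b - a)"
      using pnorm_sq_convex[OF p, of "real D" 1 "real D" "(d v - 1) / (real D - 1)"] d1[of v] dD[of v] D
      by (simp add: a_def b_def)
    finally show ?thesis .
  qed
  then have "(\<Sum>v\<in>-{r}. (sombor_weight p E v (par v))^2)
      \<le> (\<Sum>v\<in>-{r}. a + (d v - 1) / (real D - 1) * (b - a))"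
    by (intro sum_mono)
  also have "\<dots> = real (CARD('n) - 1) * a + (\<Sum>v\<in>-{r}. d v - 1) / (real D - 1) * (b - a)"
    by (simp add: sum.distrib card_Compl_singleton sum_distrib_right sum_divide_distrib)
  also have "(\<Sum>v\<in>-{r}. d v - 1) = real (CARD('n) - 1 - D)"
    using sum_excess[OF n] D by (simp add: d_def)
  finally show ?thesis using sombor_rho_le_sum[of p] by (simp add: a_def b_def)
qed

end

subsection \<open>Stars and double stars\<close>

text \<open>Among pairs with entries in \<open>[1, k]\<close>, \<open>(k, 1)\<close> is the most
  unbalanced and has the largest quotient of norm by coordinate sum. Comparisons of weights thereby
  become comparisons of degree sums, independent of \<open>p\<close>.\<close>

lemma pnorm_le_scaled:
  assumes p: "p \<ge> 1" and "1 \<le> x" "x \<le> k" "1 \<le> y" "y \<le> k"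
  shows "pnorm p x y \<le> (x + y) / (k + 1) * pnorm p k 1"
proof (rule pnorm_majorize[OF p])
  have "x \<le> y * k" "y \<le> x * k"
    using assms mult_mono[of 1 y x k] mult_mono[of 1 x y k] by auto
  then show "x \<le> (x + y) / (k + 1) * k" "y \<le> (x + y) / (k + 1) * k"
    using assms by (auto simp: field_simps)
qed (use assms in auto)

lemma power2_le_scaled:
  fixes x y u v :: real
  assumes "0 \<le> x" "x \<le> u / v * y"
  shows "x^2 \<le> u^2 * (y / v)^2"
proof -
  have "x^2 \<le> (u / v * y)^2" using assms by (intro power_mono)
  then show ?thesis by (simp add: power_mult_distrib power_divide)
qed

text \<open>The row of the centre already contains every edge weight.\<close>

lemma star_sombor_rho_ge:
  fixes E :: "'n::finite \<Rightarrow> 'n \<Rightarrow> bool"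
  assumes "is_star E" "CARD('n) \<ge> 2"
  shows "real (CARD('n) - 1) * (pnorm p (real (CARD('n) - 1)) 1)^2 \<le> (sombor_rho p E)^2"
    "0 \<le> sombor_rho p E"
proof -
  obtain c where E: "\<And>u v. E u v \<longleftrightarrow> u \<noteq> v \<and> (u = c \<or> v = c)"
    using assms(1) unfolding is_star_def by blast
  have simple: "simple_graph E" by (auto simp: simple_graph_def E)
  have c: "{u. E c u} = -{c}" and l: "\<And>v. v \<noteq> c \<Longrightarrow> {u. E v u} = {c}" by (auto simp: E)
  have "(\<Sum>j | E c j. (sombor_weight p E c j)^2)
      = (\<Sum>j\<in>-{c}. (pnorm p (real (CARD('n) - 1)) 1)^2)"
    unfolding c by (intro sum.cong) (auto simp: sombor_weight_def degree_def c l card_Compl_singleton)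
  then show "real (CARD('n) - 1) * (pnorm p (real (CARD('n) - 1)) 1)^2 \<le> (sombor_rho p E)^2"
    using sombor_rho_ge_row(2)[OF simple, where c = c and p = p] by (simp add: card_Compl_singleton)
  show "0 \<le> sombor_rho p E" by (rule sombor_rho_ge_row(1)[OF simple])
qed

text \<open>\<open>L\<close> and \<open>K\<close> are the leaf sets at the centres \<open>a\<close>
  and \<open>b\<close>. The formula in \<open>edge_iff\<close> is that of
  \<open>is_double_star\<close>, so instances arise by unfolding.\<close>

locale double_star =
  fixes E :: "'n::finite \<Rightarrow> 'n \<Rightarrow> bool" and a b :: 'n and L K :: "'n set"
  assumes ab: "a \<noteq> b" and L: "L \<subseteq> UNIV - {a, b}" and K: "K = UNIV - {a, b} - L"
    and edge_iff: "E u v \<longleftrightarrow>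
        ((u = a \<and> v = b) \<or> (u = b \<and> v = a) \<or>
         (u = a \<and> v \<in> L) \<or> (v = a \<and> u \<in> L) \<or>
         (u = b \<and> v \<notin> L \<union> {a, b}) \<or> (v = b \<and> u \<notin> L \<union> {a, b}))"
begin

lemma simple: "simple_graph E"
  using ab L by (auto simp: simple_graph_def edge_iff)

lemma nbrs: "{u. E a u} = insert b L" "{u. E b u} = insert a K"
    "x \<in> L \<Longrightarrow> {u. E x u} = {a}" "x \<in> K \<Longrightarrow> {u. E x u} = {b}"
  using ab L by (auto simp: edge_iff K)

lemma notin [simp]: "a \<notin> L" "b \<notin> L" "a \<notin> K" "b \<notin> K"
  using L K by auto

lemma degrees: "degree E a = card L + 1" "degree E b = card K + 1"
    "x \<in> L \<Longrightarrow> degree E x = 1" "x \<in> K \<Longrightarrow> degree E x = 1"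
  by (simp_all add: degree_def nbrs)

lemma card_K: "card L + card K + 2 = CARD('n)"
proof -
  have "UNIV = insert a (insert b (L \<union> K))" "L \<inter> K = {}" using K by auto
  then have "CARD('n) = card (insert a (insert b (L \<union> K)))" by simp
  also have "\<dots> = 2 + card (L \<union> K)" using ab by simp
  finally show ?thesis using \<open>L \<inter> K = {}\<close> by (simp add: card_Un_disjoint)
qed

definition "wa p = pnorm p (real (card L + 1)) 1"
definition "wb p = pnorm p (real (card K + 1)) 1"
definition "wab p = pnorm p (real (card L + 1)) (real (card K + 1))"

lemma weights: "sombor_weight p E a b = wab p" "sombor_weight p E b a = wab p"
    "x \<in> L \<Longrightarrow> sombor_weight p E a x = wa p" "x \<in> L \<Longrightarrow> sombor_weight p E x a = wa p"
    "x \<in> K \<Longrightarrow> sombor_weight p E b x = wb p" "x \<in> K \<Longrightarrow> sombor_weight p E x b = wb p"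
  by (simp_all add: sombor_weight_def degrees wa_def wb_def wab_def pnorm_commute[of p 1]
      pnorm_commute[of p "1 + real (card K)" "1 + real (card L)"])

lemma rho_nonneg: "0 \<le> sombor_rho p E"
  by (rule sombor_rho_ge_row(1)[OF simple])

lemma rho_ge: "real (card K) * (wb p)^2 + (wab p)^2 \<le> (sombor_rho p E)^2"
  using sombor_rho_ge_row(2)[OF simple, where c = b and p = p]
  by (simp add: nbrs weights add.commute)

text \<open>The colour classes are \<open>a\<close> with \<open>K\<close> and \<open>b\<close> with
  \<open>L\<close>; the bound is the sum of all squared edge weights.\<close>

lemma rho_le: "(sombor_rho p E)^2 \<le> real (card L) * (wa p)^2 + real (card K) * (wb p)^2 + (wab p)^2"
proof -
  define g where "g i = (\<Sum>j | E i j. (sombor_weight p E i j)^2)" for i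
  have "E i j \<Longrightarrow> (i = a \<or> i \<in> K) \<noteq> (j = a \<or> j \<in> K)" for i j
    using ab L K unfolding edge_iff by auto
  from sombor_rho_le_bipartite[OF simple this, where p = p]
  have "2 * (sombor_rho p E)^2 \<le> (\<Sum>i\<in>UNIV. g i)" by (simp add: g_def)
  also have "(\<Sum>i\<in>UNIV. g i) = (\<Sum>i\<in>insert a (insert b (L \<union> K)). g i)"
    using K by (intro sum.cong) auto
  also have "\<dots> = g a + g b + ((\<Sum>i\<in>L. g i) + (\<Sum>i\<in>K. g i))"
    using ab K by (subst sum.union_disjoint[symmetric]) auto
  also have "\<dots> = ((wab p)^2 + real (card L) * (wa p)^2) + ((wab p)^2 + real (card K) * (wb p)^2)
      + (real (card L) * (wa p)^2 + real (card K) * (wb p)^2)"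
    unfolding g_def by (simp add: nbrs weights)
  finally show ?thesis by simp
qed

text \<open>Multiplying the equations at the centres by the eigenvalue eliminates the leaves and
  leaves two linear relations between \<open>y a\<close> and \<open>y b\<close>, whose product is
  the claim.\<close>

lemma rho_sq_eq:
  assumes pos: "sombor_rho p E > 0" and C: "wab p > 0"
  defines "t \<equiv> (sombor_rho p E)^2"
  shows "(t - real (card L) * (wa p)^2) * (t - real (card K) * (wb p)^2) = (wab p)^2 * t"
proof -
  define \<rho> where "\<rho> = sombor_rho p E"
  obtain y where nz: "\<exists>i. y i \<noteq> 0" and ev: "\<And>i. \<rho> * y i = (\<Sum>j | E i j. sombor_weight p E i j * y j)"
    using sombor_rho_eigenvector[OF simple] unfolding \<rho>_def by blast
  have \<rho>: "\<rho> > 0" using pos by (simp add: \<rho>_def)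
  have yL: "\<rho> * y x = wa p * y a" if "x \<in> L" for x using ev[of x] that by (simp add: nbrs weights)
  have yK: "\<rho> * y x = wb p * y b" if "x \<in> K" for x using ev[of x] that by (simp add: nbrs weights)
  have a: "\<rho> * y a = wab p * y b + (\<Sum>j\<in>L. wa p * y j)"
    using ev[of a] by (simp add: nbrs weights)
  have "\<rho> * (\<Sum>j\<in>L. wa p * y j) = (\<Sum>j\<in>L. wa p * (\<rho> * y j))"
    by (simp add: sum_distrib_left mult.left_commute)
  also have "\<dots> = real (card L) * (wa p)^2 * y a" using yL by (simp add: power2_eq_square)
  finally have a2: "(\<rho>^2 - real (card L) * (wa p)^2) * y a = wab p * \<rho> * y b"
    using arg_cong[OF a, of "\<lambda>x. \<rho> * x"] by (simp add: algebra_simps power2_eq_square)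
  have b: "\<rho> * y b = wab p * y a + (\<Sum>j\<in>K. wb p * y j)"
    using ev[of b] by (simp add: nbrs weights)
  have "\<rho> * (\<Sum>j\<in>K. wb p * y j) = (\<Sum>j\<in>K. wb p * (\<rho> * y j))"
    by (simp add: sum_distrib_left mult.left_commute)
  also have "\<dots> = real (card K) * (wb p)^2 * y b" using yK by (simp add: power2_eq_square)
  finally have b2: "(\<rho>^2 - real (card K) * (wb p)^2) * y b = wab p * \<rho> * y a"
    using arg_cong[OF b, of "\<lambda>x. \<rho> * x"] by (simp add: algebra_simps power2_eq_square)
  have "y a \<noteq> 0"
  proof
    assume ya: "y a = 0"
    then have yb: "y b = 0" using a2 \<rho> C by simp
    have "y i = 0" for i
      using yL[of i] yK[of i] ya yb \<rho> K by (cases "i \<in> L"; cases "i = a \<or> i = b") auto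
    with nz show False by blast
  qed
  have "(\<rho>^2 - real (card L) * (wa p)^2) * (\<rho>^2 - real (card K) * (wb p)^2) * y a
      = (\<rho>^2 - real (card K) * (wb p)^2) * (wab p * \<rho> * y b)"
    unfolding a2[symmetric] by (simp only: mult_ac)
  also have "\<dots> = (wab p * \<rho>) * (wab p * \<rho> * y a)"
    unfolding b2[symmetric] by (simp only: mult_ac)
  also have "\<dots> = (wab p)^2 * \<rho>^2 * y a" by (simp only: power2_eq_square mult_ac)
  finally have "(\<rho>^2 - real (card L) * (wa p)^2) * (\<rho>^2 - real (card K) * (wb p)^2) = (wab p)^2 * \<rho>^2"
    by (rule mult_right_cancel[THEN iffD1, OF \<open>y a \<noteq> 0\<close>])
  then show ?thesis by (simp only: t_def \<rho>_def)
qed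

end

section \<open>Strict comparisons between the star and the two double stars\<close>

lemma is_double_star_obtain:
  fixes E :: "'n::finite \<Rightarrow> 'n \<Rightarrow> bool"
  assumes "is_double_star d E"
  obtains a b L K where "double_star E a b L K" "card L = d - 1" "card L + card K + 2 = CARD('n)"
proof -
  obtain a b L where "double_star E a b L (UNIV - {a, b} - L)" and "card L = d - 1"
    using assms unfolding is_double_star_def double_star_def by blast
  with double_star.card_K[OF this(1)] that show thesis by blast
qed

text \<open>The sum of all squared weights of \<open>S2\<close> stays below the squared row norm at
  the centre of \<open>Sn\<close>. Measured in units of \<open>\<beta>\<close>, each squared weight
  of \<open>S2\<close> is bounded by a squared degree sum, except that the central edge is bounded
  by a star edge; a cubic inequality in \<open>N\<close> remains.\<close>

lemma sombor_rho_double_star_less_star: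
  fixes S2 Sn :: "'n::finite \<Rightarrow> 'n \<Rightarrow> bool"
  assumes p: "p \<ge> 1" and n: "CARD('n) \<ge> 4" and "is_star Sn" "is_double_star 2 S2"
  shows "sombor_rho p S2 < sombor_rho p Sn"
proof -
  obtain a b L K where "double_star S2 a b L K" and c: "card L = 2 - 1" "card L + card K + 2 = CARD('n)"
    using is_double_star_obtain[OF assms(4)] .
  then interpret double_star S2 a b L K by simp
  define N where "N = real CARD('n)"
  have N4: "N \<ge> 4" using n by (simp add: N_def)
  have cK: "real (card K) = N - 3" and cL: "card L = 1" and c1: "real (CARD('n) - 1) = N - 1"
    using c n by (auto simp: N_def)
  define y where "y = pnorm p (N - 1) 1"
  have y: "y > 0" unfolding y_def using N4 by (intro pnorm_pos[OF p]) auto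
  define \<beta> where "\<beta> = (y / N)^2"
  have \<beta>: "\<beta> > 0" "y^2 = N^2 * \<beta>" using y N4 by (auto simp: \<beta>_def power_divide)
  have "wa p \<le> 3 / N * y"
    unfolding wa_def y_def cL using N4 by (intro pnorm_majorize[OF p]) (auto simp: field_simps)
  then have 1: "(wa p)^2 \<le> 9 * \<beta>" using power2_le_scaled[of "wa p" 3 N y] by (simp add: wa_def \<beta>_def)
  have "wb p \<le> (N - 1) / N * y"
    using pnorm_le_scaled[OF p, of "N - 2" "N - 1" 1] N4 by (simp add: wb_def y_def cK)
  then have 2: "(wb p)^2 \<le> (N - 1)^2 * \<beta>"
    using power2_le_scaled[of "wb p" "N - 1" N y] by (simp add: wb_def \<beta>_def)
  have "wab p \<le> 1 * y"
    unfolding wab_def y_def cL using N4 by (intro pnorm_majorize[OF p]) (auto simp: cK)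
  then have 3: "(wab p)^2 \<le> N^2 * \<beta>"
    unfolding \<beta>(2)[symmetric] by (intro power_mono) (auto simp: wab_def)
  have "(sombor_rho p S2)^2 \<le> (wa p)^2 + (N - 3) * (wb p)^2 + (wab p)^2"
    using rho_le[of p] by (simp add: cK cL)
  also have "\<dots> \<le> 9 * \<beta> + (N - 3) * ((N - 1)^2 * \<beta>) + N^2 * \<beta>"
    using 1 2 3 N4 by (intro add_mono mult_left_mono) auto
  also have "\<dots> = (9 + (N - 3) * (N - 1)^2 + N^2) * \<beta>" by (simp add: algebra_simps)
  also have "\<dots> < ((N - 1) * N^2) * \<beta>"
  proof (rule mult_strict_right_mono[OF _ \<beta>(1)])
    \<comment> \<open>Expanding around \<open>N = 4\<close> makes every summand visibly
      nonnegative.\<close>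
    have "(N - 1) * N^2 - (9 + (N - 3) * (N - 1)^2 + N^2) = 3 * N * (N - 4) + 5 * (N - 4) + 14"
      by (simp add: algebra_simps power2_eq_square)
    also have "\<dots> > 0"
      using N4 by (intro add_nonneg_pos add_nonneg_nonneg mult_nonneg_nonneg) auto
    finally show "9 + (N - 3) * (N - 1)^2 + N^2 < (N - 1) * N^2" by (simp only: diff_gt_0_iff_gt)
  qed
  also have "\<dots> = (N - 1) * y^2" by (simp add: \<beta>(2))
  also have "\<dots> \<le> (sombor_rho p Sn)^2"
    using star_sombor_rho_ge(1)[OF assms(3), of p] n unfolding c1 y_def by simp
  finally show ?thesis
    by (rule power_less_imp_less_base) (use star_sombor_rho_ge(2)[OF assms(3)] n in simp)
qed

text \<open>The same two bounds, with the larger pendant weight of \<open>S2\<close> as unit. The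
  central edges are compared directly, since \<open>(N - 3, 3)\<close> is majorized by
  \<open>(N - 2, 2)\<close>, and cancel.\<close>

lemma sombor_rho_double_star_3_less_2:
  fixes S2 S3 :: "'n::finite \<Rightarrow> 'n \<Rightarrow> bool"
  assumes p: "p \<ge> 1" and n: "CARD('n) \<ge> 6" and "is_double_star 2 S2" "is_double_star 3 S3"
  shows "sombor_rho p S3 < sombor_rho p S2"
proof -
  obtain a b L K where "double_star S2 a b L K" and c: "card L = 2 - 1" "card L + card K + 2 = CARD('n)"
    using is_double_star_obtain[OF assms(3)] .
  then interpret S2: double_star S2 a b L K by simp
  obtain a' b' L' K' where "double_star S3 a' b' L' K'"
    and c': "card L' = 3 - 1" "card L' + card K' + 2 = CARD('n)"
    using is_double_star_obtain[OF assms(4)] .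
  then interpret S3: double_star S3 a' b' L' K' by simp
  define N where "N = real CARD('n)"
  have N6: "N \<ge> 6" using n by (simp add: N_def)
  have cK: "real (card K) = N - 3" and cL: "card L = 1"
    and cK': "real (card K') = N - 4" and cL': "card L' = 2"
    using c c' n by (auto simp: N_def)
  define y where "y = S2.wb p"
  have y: "y > 0" unfolding y_def S2.wb_def using N6 by (intro pnorm_pos[OF p]) auto
  define \<beta> where "\<beta> = (y / (N - 1))^2"
  have \<beta>: "\<beta> > 0" "y^2 = (N - 1)^2 * \<beta>" using y N6 by (auto simp: \<beta>_def power_divide)
  have "S3.wa p \<le> 4 / (N - 1) * y"
    unfolding S3.wa_def S2.wb_def y_def cL' using N6
    by (intro pnorm_majorize[OF p]) (auto simp: field_simps cK)
  then have 1: "(S3.wa p)^2 \<le> 16 * \<beta>"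
    using power2_le_scaled[of "S3.wa p" 4 "N - 1" y] by (simp add: S3.wa_def \<beta>_def)
  have "S3.wb p \<le> (N - 2) / (N - 1) * y"
    using pnorm_le_scaled[OF p, of "N - 3" "N - 2" 1] N6
    by (simp add: S3.wb_def S2.wb_def y_def cK cK')
  then have 2: "(S3.wb p)^2 \<le> (N - 2)^2 * \<beta>"
    using power2_le_scaled[of "S3.wb p" "N - 2" "N - 1" y] by (simp add: S3.wb_def \<beta>_def)
  have "S3.wab p \<le> 1 * S2.wab p"
    unfolding S3.wab_def S2.wab_def cL cL' pnorm_commute[of p "real (1 + 1)"] using N6
    by (intro pnorm_majorize[OF p]) (auto simp: cK cK')
  then have 3: "(S3.wab p)^2 \<le> (S2.wab p)^2"
    by (intro power_mono) (auto simp: S3.wab_def)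
  have "(sombor_rho p S3)^2 \<le> 2 * (S3.wa p)^2 + (N - 4) * (S3.wb p)^2 + (S3.wab p)^2"
    using S3.rho_le[of p] by (simp add: cK' cL')
  also have "\<dots> \<le> 2 * (16 * \<beta>) + (N - 4) * ((N - 2)^2 * \<beta>) + (S2.wab p)^2"
    using 1 2 3 N6 by (intro add_mono mult_left_mono) auto
  also have "\<dots> = (32 + (N - 4) * (N - 2)^2) * \<beta> + (S2.wab p)^2" by (simp add: algebra_simps)
  also have "\<dots> < ((N - 3) * (N - 1)^2) * \<beta> + (S2.wab p)^2"
  proof (intro add_strict_right_mono mult_strict_right_mono[OF _ \<beta>(1)])
    have "(N - 3) * (N - 1)^2 - (32 + (N - 4) * (N - 2)^2) = 3 * N * (N - 6) + 5 * (N - 6) + 11"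
      by (simp add: algebra_simps power2_eq_square)
    also have "\<dots> > 0"
      using N6 by (intro add_nonneg_pos add_nonneg_nonneg mult_nonneg_nonneg) auto
    finally show "32 + (N - 4) * (N - 2)^2 < (N - 3) * (N - 1)^2" by (simp only: diff_gt_0_iff_gt)
  qed
  also have "\<dots> = (N - 3) * y^2 + (S2.wab p)^2" by (simp add: \<beta>(2))
  also have "\<dots> \<le> (sombor_rho p S2)^2"
    using S2.rho_ge[of p] by (simp add: y_def cK)
  finally show ?thesis
    by (rule power_less_imp_less_base) (rule S2.rho_nonneg)
qed

text \<open>Here \<open>k\<close> is the degree of \<open>b\<close>. The second fact is the
  eigenvalue equation in fixed-point form, against which other trees are tested; the third improves
  the row bound by \<open>2 / k * A^2\<close>.\<close>

lemma (in double_star) double_star_3_rho_sq: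
  assumes p: "p \<ge> 1" and n: "CARD('n) \<ge> 6" and L2: "card L = 2"
  defines "t \<equiv> (sombor_rho p E)^2" and "k \<equiv> real CARD('n) - 3"
  defines "A \<equiv> pnorm p 3 1" and "B \<equiv> pnorm p k 1" and "C \<equiv> pnorm p k 3"
  shows "t > 2 * A^2" "t = (k - 1) * B^2 + C^2 * t / (t - 2 * A^2)"
    "(k - 1) * B^2 + C^2 + 2 / k * A^2 \<le> t"
proof -
  have cK: "real (card K) = k - 1" using card_K n L2 by (simp add: k_def)
  have k3: "k \<ge> 3" using n by (simp add: k_def)
  have w: "wa p = A" "wb p = B" "wab p = C"
    using pnorm_commute[of p 3 k]
    by (simp_all add: wa_def wb_def wab_def A_def B_def C_def L2 cK)
  have pos: "A > 0" "B > 0" "C > 0" unfolding A_def B_def C_def using k3 by (auto intro!: pnorm_pos[OF p])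
  have AB: "A \<le> B" "B \<le> C" unfolding A_def B_def C_def using k3 by (auto intro!: pnorm_mono[OF p])
  have sq: "A^2 \<le> B^2" "B^2 \<le> C^2" using AB pos by (auto intro!: power_mono)
  have sqpos: "A^2 > 0" "B^2 > 0" "C^2 > 0" using pos by simp_all
  have ge: "(k - 1) * B^2 + C^2 \<le> t" using rho_ge[of p] by (simp add: w cK t_def)
  have kB: "2 * B^2 \<le> (k - 1) * B^2" using k3 by (intro mult_right_mono) auto
  have t0: "t > 0" using ge kB sqpos by linarith
  then have "sombor_rho p E > 0" using rho_nonneg[of p] by (auto simp: t_def less_le)
  from rho_sq_eq[OF this] pos
  have eq: "(t - 2 * A^2) * (t - (k - 1) * B^2) = C^2 * t"
    by (simp add: w cK L2 t_def)
  show gt: "t > 2 * A^2" using ge kB sq sqpos by linarith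
  have "t - (k - 1) * B^2 = C^2 * t / (t - 2 * A^2)"
    using eq gt by (simp add: eq_divide_eq mult.commute)
  then show teq: "t = (k - 1) * B^2 + C^2 * t / (t - 2 * A^2)" by linarith
  \<comment> \<open>The eigenvalue equation gives back the upper bound by the sum of all squared
    weights, so \<open>t - 2 * A^2\<close> is at most \<open>k * C^2\<close>; this bounds the
    fraction in the equation from below.\<close>
  have "t * (t - (2 * A^2 + (k - 1) * B^2 + C^2)) = - (2 * A^2 * ((k - 1) * B^2))"
    using eq by (simp add: algebra_simps)
  also have "\<dots> \<le> 0" using k3 by simp
  finally have "t \<le> 2 * A^2 + (k - 1) * B^2 + C^2"
    using t0 by (simp add: mult_le_0_iff)
  moreover have "(k - 1) * B^2 \<le> (k - 1) * C^2" using sq k3 by (intro mult_left_mono) auto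
  ultimately have "t - 2 * A^2 \<le> k * C^2" by (simp add: algebra_simps)
  then have "2 * A^2 * (t - 2 * A^2) \<le> 2 * A^2 * (k * C^2)" by (intro mult_left_mono) auto
  then have "2 / k * A^2 \<le> 2 * A^2 * C^2 / (t - 2 * A^2)"
    using gt k3 by (simp add: field_simps)
  also have "\<dots> = C^2 * t / (t - 2 * A^2) - C^2" using gt by (simp add: field_simps)
  finally show "(k - 1) * B^2 + C^2 + 2 / k * A^2 \<le> t" using teq by linarith
qed

subsection \<open>Trees of maximum degree at most n - 4\<close>

context rooted_tree
begin

text \<open>The number \<open>k\<close> is the larger degree in \<open>S\<^bsub>3,n-3\<^esub>\<close>, and \<open>A\<close>, \<open>B\<close>,
  \<open>C\<close> are its edge weights. In general comparing all but one of the weights with \<open>B\<close> is enough;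
  the orders 6, 7 and 8 need sharper comparisons with \<open>A\<close> and \<open>C\<close>.\<close>
lemma sombor_rho_sq_less_low_degree:
  assumes p: "p \<ge> 1" and n: "CARD('n) \<ge> 6" and low: "degree E r + 4 \<le> CARD('n)"
    and max: "\<And>v. degree E v \<le> degree E r"
  defines "k \<equiv> real CARD('n) - 3"
  defines "A \<equiv> pnorm p 3 1" and "B \<equiv> pnorm p k 1" and "C \<equiv> pnorm p k 3"
  shows "(sombor_rho p E)^2 < (k - 1) * B^2 + C^2 + 2 / k * A^2"
proof -
  define D where "D = degree E r"
  define t where "t = (sombor_rho p E)^2"
  have n2: "CARD('n) \<ge> 2" using n by simp
  have k3: "k \<ge> 3" using n by (simp add: k_def)
  have pos: "A > 0" "B > 0" "C > 0" unfolding A_def B_def C_def using k3 by (auto intro!: pnorm_pos[OF p])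
  have AB: "A \<le> B" "B \<le> C" unfolding A_def B_def C_def using k3 by (auto intro!: pnorm_mono[OF p])
  have BC2: "B^2 \<le> C^2" using AB pos by (intro power_mono) auto
  have A2: "A^2 > 0" "2 / k * A^2 > 0" using pos k3 by simp_all
  define \<beta> where "\<beta> = (B / (k + 1))^2"
  have \<beta>: "\<beta> > 0" "B^2 = (k + 1)^2 * \<beta>" using pos k3 by (auto simp: \<beta>_def power_divide)
  have sc: "(pnorm p x y)^2 \<le> (x + y)^2 * \<beta>" if "1 \<le> x" "x \<le> k" "1 \<le> y" "y \<le> k" for x y
    using power2_le_scaled[OF pnorm_nonneg pnorm_le_scaled[OF p that]] by (simp add: \<beta>_def B_def)
  \<comment> \<open>Maximum degree 1 would leave no excess, whereas \<open>n - 2\<close> edges would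
    have to avoid the root.\<close>
  have D1: "D \<noteq> 1"
  proof
    assume "D = 1"
    then have "(\<Sum>v\<in>-{r}. real (degree E v) - 1) \<le> 0"
      using max by (intro sum_nonpos) (auto simp: D_def)
    then show False using sum_excess[OF n2] \<open>D = 1\<close> n by (simp add: D_def)
  qed
  then consider "D \<ge> 4" "CARD('n) \<ge> 9" | "D = 4" "CARD('n) = 8" | "D = 3" "CARD('n) \<ge> 8"
    | "D = 3" "CARD('n) = 7" | "D = 2" "CARD('n) \<ge> 7" | "D = 2" "CARD('n) = 6"
    using low n degree_pos[OF n2, of r] by (force simp: D_def)
  then show ?thesis
  proof cases
    case 1
    \<comment> \<open>The leaf numbers at the two centres of the bounding double star. Both are at
      least 3, because the maximum degree lies between 4 and \<open>n - 4\<close>.\<close>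
    define M R where "M = real D - 1" and "R = k + 1 - M"
    have MR: "M \<ge> 3" "R \<ge> 3" "k = M + R - 1" "M \<le> k - 2" "R \<le> k - 2" "M + R \<ge> 7"
      using 1 low by (auto simp: M_def R_def k_def D_def)
    have R: "real (CARD('n) - 1 - D) = R" using 1 low by (auto simp: M_def R_def k_def D_def)
    have "t \<le> M * (pnorm p (M + 1) 1)^2 + (pnorm p (M + 1) (R + 1))^2 + R * (pnorm p (R + 1) 1)^2"
      using sombor_rho_le_double_star[OF p n2 refl] 1 low R
      unfolding D_def[symmetric] R t_def by (simp add: M_def)
    also have "pnorm p (M + 1) (R + 1) \<le> 1 * C"
      unfolding C_def using MR by (intro pnorm_majorize[OF p]) auto
    then have "(pnorm p (M + 1) (R + 1))^2 \<le> C^2" by (intro power_mono) auto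
    also have "(pnorm p (M + 1) 1)^2 \<le> (M + 2)^2 * \<beta>" using sc[of "M + 1" 1] MR by (simp add: add.commute)
    also have "(pnorm p (R + 1) 1)^2 \<le> (R + 2)^2 * \<beta>" using sc[of "R + 1" 1] MR by (simp add: add.commute)
    finally have "t \<le> (M * (M + 2)^2 + R * (R + 2)^2) * \<beta> + C^2"
      using MR by (simp add: algebra_simps)
    also have "\<dots> < ((M + R - 2) * (M + R)^2) * \<beta> + C^2"
    proof (intro add_strict_right_mono mult_strict_right_mono[OF _ \<beta>(1)])
      define S where "S = M + R"
      have S: "S \<ge> 7" using MR by (simp add: S_def)
      \<comment> \<open>For a fixed sum \<open>S\<close> the product \<open>M * R\<close> is least
        at the extreme split with one part equal to 3.\<close>
      have "(M - 3) * (R - 3) \<ge> 0" using MR by (intro mult_nonneg_nonneg) auto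
      then have P: "M * R - 3 * (S - 3) \<ge> 0" by (simp add: S_def algebra_simps)
      have "(M + R - 2) * (M + R)^2 - (M * (M + 2)^2 + R * (R + 2)^2)
          = (M * R - 3 * (S - 3)) * (3 * S + 8) + (3 * S * (S - 7) + 14 * (S - 7) + 26)"
        by (simp add: S_def algebra_simps power2_eq_square)
      also have "\<dots> > 0"
        using S P by (intro add_nonneg_pos add_nonneg_nonneg mult_nonneg_nonneg) auto
      finally show "M * (M + 2)^2 + R * (R + 2)^2 < (M + R - 2) * (M + R)^2"
        by (simp only: diff_gt_0_iff_gt)
    qed
    also have "\<dots> = (k - 1) * B^2 + C^2" unfolding \<beta>(2) MR(3) by simp
    finally show ?thesis using A2 by (simp add: t_def)
  next
    case 2
    then have k: "k = 5" by (simp add: k_def)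
    define H where "H = pnorm p 4 1"
    have "t \<le> 3 * H^2 + (pnorm p 4 4)^2 + 3 * H^2"
      using sombor_rho_le_double_star[OF p n2 refl] 2 low
      unfolding D_def[symmetric] t_def by (simp add: H_def)
    also have "pnorm p 4 4 \<le> 1 * C"
      unfolding C_def k by (intro pnorm_majorize[OF p]) auto
    then have "(pnorm p 4 4)^2 \<le> C^2" by (intro power_mono) auto
    finally have t6: "t \<le> 6 * H^2 + C^2" by simp
    \<comment> \<open>The pair \<open>(4, 1)\<close> is the midpoint of \<open>(3, 1)\<close> and
      \<open>(5, 1)\<close>.\<close>
    have "2 * H \<le> A + B"
      using pnorm_triangle[OF p, of 3 1 5 1] pnorm_scale[OF p, of 2 4 1]
      by (simp add: H_def A_def B_def k)
    then have "(2 * H)^2 \<le> (A + B)^2" by (intro power_mono) (auto simp: H_def)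
    then have t1: "t \<le> 3 / 2 * A^2 + 3 * (A * B) + 3 / 2 * B^2 + C^2"
      using t6 by (simp add: power_mult_distrib power2_sum)
    have "A \<le> 4 / 6 * B" using pnorm_le_scaled[OF p, of 3 5 1] by (simp add: A_def B_def k)
    then have "A * A \<le> 4 / 6 * (A * B)" "A * B \<le> 4 / 6 * (B * B)"
      using pos mult_left_mono[of A "4 / 6 * B" A] mult_right_mono[of A "4 / 6 * B" B] by auto
    \<comment> \<open>The summand \<open>2 / 5 * A^2\<close> of the target is already subtracted
      from \<open>3 / 2 * A^2\<close>. What is left fits because \<open>112 / 45\<close> is just
      below \<open>4 - 3 / 2\<close>.\<close>
    then have "11 / 10 * A^2 + 3 * (A * B) \<le> 112 / 45 * B^2"
      by (simp add: power2_eq_square)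
    moreover have "B^2 > 0" using pos by simp
    ultimately have "t < 2 / 5 * A^2 + 4 * B^2 + C^2" using t1 by linarith
    then show ?thesis by (simp add: t_def k)
  next
    case 3
    have k5: "k \<ge> 5" using 3 by (simp add: k_def)
    define h where "h = (pnorm p 3 3)^2"
    have "t \<le> (k + 2) * A^2 + (k - 1) / 2 * (h - A^2)"
      using sombor_rho_le_max_degree[OF p n2 D_def _ max[folded D_def]] 3
      by (simp add: t_def A_def h_def k_def of_nat_diff)
    also have "\<dots> = (k + 5) / 2 * A^2 + (k - 1) / 2 * h" by (simp add: field_simps)
    also have "\<dots> \<le> (k + 5) / 2 * (4^2 * \<beta>) + (k - 1) / 2 * (6^2 * \<beta>)"
      using sc[of 3 1] sc[of 3 3] k5 unfolding A_def h_def by (intro add_mono mult_left_mono) auto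
    also have "\<dots> = (26 * k + 22) * \<beta>" by (simp add: field_simps)
    also have "\<dots> < (k * (k + 1)^2) * \<beta>"
    proof (rule mult_strict_right_mono[OF _ \<beta>(1)])
      have "k * (k + 1)^2 - (26 * k + 22) = (k - 5) * (k * k + 7 * k + 10) + 28"
        by (simp add: algebra_simps power2_eq_square)
      also have "\<dots> > 0" using k5 by (intro add_nonneg_pos mult_nonneg_nonneg add_nonneg_nonneg) auto
      finally show "26 * k + 22 < k * (k + 1)^2" by (simp only: diff_gt_0_iff_gt)
    qed
    also have "\<dots> = (k - 1) * B^2 + B^2" by (simp add: \<beta>(2) algebra_simps)
    also have "\<dots> < (k - 1) * B^2 + C^2 + 2 / k * A^2" using BC2 A2 by linarith
    finally show ?thesis by (simp add: t_def)
  next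
    case 4
    then have k: "k = 4" by (simp add: k_def)
    define h where "h = (pnorm p 3 3)^2"
    have "t \<le> 6 * A^2 + 3 / 2 * (h - A^2)"
      using sombor_rho_le_max_degree[OF p n2 D_def _ max[folded D_def]] 4
      by (simp add: t_def A_def h_def)
    then have "t \<le> 9 / 2 * A^2 + 3 / 2 * h" by (simp add: field_simps)
    moreover have "A^2 \<le> 16 / 25 * B^2"
      using sc[of 3 1] \<beta>(2) by (simp add: A_def k)
    \<comment> \<open>Comparing with \<open>C\<close> rather than \<open>B\<close> lets the result
      cancel against \<open>C^2\<close> in the target; only the surplus \<open>5 / 49 * C^2\<close>
      has to be converted to \<open>B^2\<close>.\<close>
    moreover have "pnorm p 3 3 \<le> 6 / 7 * C"
      unfolding C_def k by (rule pnorm_majorize[OF p]) auto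
    then have "h \<le> (6 / 7 * C)^2" unfolding h_def by (intro power_mono) auto
    then have "h \<le> 36 / 49 * C^2" by (simp add: power_mult_distrib power_divide)
    moreover have "C \<le> 7 / 5 * B"
      unfolding C_def B_def k by (rule pnorm_majorize[OF p]) auto
    then have "C^2 \<le> (7 / 5 * B)^2" using pos by (intro power_mono) auto
    then have "C^2 \<le> 49 / 25 * B^2" by (simp add: power_mult_distrib power_divide)
    moreover have "B^2 > 0" using pos by simp
    ultimately have "t < 3 * B^2 + C^2 + 1 / 2 * A^2" by linarith
    then show ?thesis by (simp add: t_def k)
  next
    case 5
    have k4: "k \<ge> 4" using 5 by (simp add: k_def)
    define h where "h = (pnorm p 2 2)^2"
    define e where "e = (pnorm p 2 1)^2"
    have "t \<le> (k + 2) * e + k * (h - e)"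
      using sombor_rho_le_max_degree[OF p n2 D_def _ max[folded D_def]] 5
      by (simp add: t_def e_def h_def k_def of_nat_diff)
    also have "\<dots> = 2 * e + k * h" by (simp add: field_simps)
    also have "\<dots> \<le> 2 * (3^2 * \<beta>) + k * (4^2 * \<beta>)"
      using sc[of 2 1] sc[of 2 2] k4 unfolding e_def h_def by (intro add_mono mult_left_mono) auto
    also have "\<dots> = (16 * k + 18) * \<beta>" by (simp add: field_simps)
    also have "\<dots> < (k * (k + 1)^2) * \<beta>"
    proof (rule mult_strict_right_mono[OF _ \<beta>(1)])
      have "k * (k + 1)^2 - (16 * k + 18) = (k - 4) * (k * k + 6 * k + 9) + 18"
        by (simp add: algebra_simps power2_eq_square)
      also have "\<dots> > 0" using k4 by (intro add_nonneg_pos mult_nonneg_nonneg add_nonneg_nonneg) auto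
      finally show "16 * k + 18 < k * (k + 1)^2" by (simp only: diff_gt_0_iff_gt)
    qed
    also have "\<dots> = (k - 1) * B^2 + B^2" by (simp add: \<beta>(2) algebra_simps)
    also have "\<dots> < (k - 1) * B^2 + C^2 + 2 / k * A^2" using BC2 A2 by linarith
    finally show ?thesis by (simp add: t_def)
  next
    case 6
    then have k: "k = 3" by (simp add: k_def)
    define h where "h = (pnorm p 2 2)^2"
    define e where "e = (pnorm p 2 1)^2"
    have "t \<le> 5 * e + 3 * (h - e)"
      using sombor_rho_le_max_degree[OF p n2 D_def _ max[folded D_def]] 6
      by (simp add: t_def e_def h_def)
    then have "t \<le> 2 * e + 3 * h" by simp
    moreover have "e \<le> 9 / 16 * B^2"
      using sc[of 2 1] \<beta>(2) by (simp add: e_def k)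
    \<comment> \<open>Again \<open>C^2\<close> cancels and only a third of it is converted to
      \<open>B^2\<close>.\<close>
    moreover have "pnorm p 2 2 \<le> 2 / 3 * C"
      unfolding C_def k by (rule pnorm_majorize[OF p]) auto
    then have "h \<le> (2 / 3 * C)^2" unfolding h_def by (intro power_mono) auto
    then have "h \<le> 4 / 9 * C^2" by (simp add: power_mult_distrib power_divide)
    moreover have "C \<le> 3 / 2 * B"
      unfolding C_def B_def k by (rule pnorm_majorize[OF p]) auto
    then have "C^2 \<le> (3 / 2 * B)^2" using pos by (intro power_mono) auto
    then have "C^2 \<le> 9 / 4 * B^2" by (simp add: power_mult_distrib power_divide)
    moreover have "B^2 > 0" using pos by simp
    ultimately have "t < 2 * B^2 + C^2" by linarith
    moreover have "(k - 1) * B^2 = 2 * B^2" by (simp add: k)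
    ultimately show ?thesis using A2(2) unfolding t_def by linarith
  qed
qed

end

subsection \<open>Trees of maximum degree n - 3\<close>

text \<open>Solved for the linear term, the equation of \<open>\<tau>\<close> has a right-hand side
  that decreases in \<open>\<tau>\<close>. At any \<open>\<tau>\<close> not below \<open>t\<close>
  it falls short of the corresponding expression for \<open>t\<close>.\<close>

lemma no_large_root_two_legs:
  fixes A B C D F k t \<tau> :: real
  assumes k: "k \<ge> 3" and pos: "A > 0" "B > 0" "C > 0" and le: "F^2 \<le> A^2" "B^2 \<le> C^2"
    and D: "2 * D^2 \<le> B^2 + C^2"
    and t: "t > 2 * A^2" "t = (k - 1) * B^2 + C^2 * t / (t - 2 * A^2)"
    and \<tau>: "(\<tau> - F^2) * (\<tau> - (k - 2) * B^2) = 2 * D^2 * \<tau>"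
  shows "\<tau> < t"
proof (rule ccontr)
  assume "\<not> \<tau> < t"
  then have ge: "t \<le> \<tau>" by simp
  have A2: "A^2 > 0" and C2: "C^2 > 0" using pos by simp_all
  have tF: "t - F^2 > 0" "t - 2 * A^2 < t - F^2" "\<tau> - F^2 > 0" using t(1) le ge A2 by linarith+
  have "\<tau> - (k - 2) * B^2 = 2 * D^2 * \<tau> / (\<tau> - F^2)" using \<tau> tF by (simp add: field_simps)
  also have "\<dots> = 2 * D^2 * (1 + F^2 / (\<tau> - F^2))" using tF by (simp add: field_simps)
  also have "\<dots> \<le> (B^2 + C^2) * (1 + F^2 / (t - F^2))"
    using tF ge D by (intro mult_mono add_left_mono divide_left_mono) auto
  finally have "\<tau> \<le> (k - 1) * B^2 + C^2 + (B^2 + C^2) * (F^2 / (t - F^2))"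
    by (simp add: algebra_simps)
  \<comment> \<open>The target is \<open>2 * C^2 * A^2 / (t - 2 * A^2)\<close>, the amount by which
    \<open>C^2 * t / (t - 2 * A^2)\<close> exceeds \<open>C^2\<close>.\<close>
  also have "(B^2 + C^2) * (F^2 / (t - F^2)) \<le> (2 * C^2) * (A^2 / (t - F^2))"
    using tF le by (intro mult_mono divide_right_mono) auto
  also have "\<dots> < (2 * C^2) * (A^2 / (t - 2 * A^2))"
    using tF t(1) A2 C2 by (intro mult_strict_left_mono divide_strict_left_mono) auto
  also have "(k - 1) * B^2 + C^2 + (2 * C^2) * (A^2 / (t - 2 * A^2))
      = (k - 1) * B^2 + C^2 * t / (t - 2 * A^2)"
    using t(1) by (simp add: field_simps)
  finally show False using ge t(2) by linarith
qed

text \<open>The same monotonicity argument. Both equations have the form of a central weight times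
  one plus a correction, and the correction for \<open>\<tau>\<close> is the smaller one.\<close>

lemma no_large_root_long_leg:
  fixes A B C D F G k t \<tau> :: real
  assumes k: "k \<ge> 3" and pos: "A > 0" "B > 0" "C > 0" "D > 0"
    and le: "G^2 \<le> A^2" "F^2 \<le> B^2" "A^2 \<le> B^2" "D^2 \<le> C^2"
    and t: "t > 2 * A^2" "t = (k - 1) * B^2 + C^2 * t / (t - 2 * A^2)" "(k - 1) * B^2 + C^2 \<le> t"
    and \<tau>: "(\<tau> - (k - 1) * B^2) * (\<tau> - F^2 - G^2) = D^2 * (\<tau> - F^2)"
  shows "\<tau> < t"
proof (rule ccontr)
  assume "\<not> \<tau> < t"
  then have ge: "t \<le> \<tau>" by simp
  have p2: "A^2 > 0" "C^2 > 0" "B^2 > 0" "D^2 > 0" using pos by simp_all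
  have "2 * B^2 \<le> (k - 1) * B^2" using k by (intro mult_right_mono) auto
  then have t2: "2 * B^2 < t" using t(3) p2 by linarith
  then have t0: "t > 0" using p2 by linarith
  define s where "s = \<tau> - F^2 - G^2"
  have s: "s > 0" using t2 le ge by (simp add: s_def)
  have u: "t - 2 * A^2 > 0" using t(1) by simp
  have "\<tau> - (k - 1) * B^2 = D^2 * (s + G^2) / s" using \<tau> s by (simp add: s_def field_simps)
  also have "\<dots> = D^2 * (1 + G^2 / s)" using s by (simp add: field_simps)
  also have "\<dots> \<le> C^2 * (1 + G^2 / s)" using s le by (intro mult_right_mono) auto
  also have "\<dots> < C^2 * (1 + 2 * A^2 / (t - 2 * A^2))"
  proof (intro mult_strict_left_mono add_strict_left_mono p2)
    \<comment> \<open>Cross-multiplied, the comparison of corrections reads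
      \<open>G^2 * t < 2 * A^2 * (\<tau> - F^2)\<close>; the factor 2 is supplied by
      \<open>t > 2 * B^2\<close>.\<close>
    have t\<tau>: "t < 2 * (\<tau> - F^2)" using le(2) ge t2 by (simp add: algebra_simps)
    have "G^2 * t \<le> A^2 * t" using le t0 by (intro mult_right_mono) auto
    also have "\<dots> < A^2 * (2 * (\<tau> - F^2))"
      by (rule mult_strict_left_mono[OF t\<tau> p2(1)])
    finally have "G^2 * (t - 2 * A^2) < 2 * A^2 * s" by (simp add: s_def algebra_simps)
    then show "G^2 / s < 2 * A^2 / (t - 2 * A^2)" using s u by (simp add: field_simps)
  qed
  also have "\<dots> = C^2 * t / (t - 2 * A^2)" using u by (simp add: field_simps)
  finally show False using ge t(2) by linarith
qed

section \<open>Trees with few vertices at distance at least 2 from the root\<close>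

context rooted_tree
begin

definition "kids = {v. E r v}"
definition "far = - {r} - kids"

lemma kids: "v \<in> kids \<longleftrightarrow> v \<noteq> r \<and> par v = r"
  unfolding kids_def edge_iff by auto

lemma far: "v \<in> far \<longleftrightarrow> v \<noteq> r \<and> par v \<noteq> r"
  unfolding far_def by (auto simp: kids)

lemma card_kids: "card kids = degree E r"
  by (simp add: kids_def degree_def)

lemma card_far: "card far = CARD('n) - 1 - degree E r"
proof -
  have "kids \<subseteq> -{r}" by (auto simp: kids)
  then show ?thesis
    by (simp add: far_def card_Diff_subset card_Compl_singleton card_kids finite_subset)
qed

lemma nbrs_nonroot: "x \<noteq> r \<Longrightarrow> {u. E x u} = insert (par x) {u. u \<noteq> r \<and> par u = x}"
  by (auto simp: edge_iff)

lemma star_if_far_empty: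
  assumes "far = {}"
  shows "is_star E"
  unfolding is_star_def
proof (intro exI allI)
  have "par v = r" if "v \<noteq> r" for v using assms far[of v] that by blast
  then show "E u v \<longleftrightarrow> u \<noteq> v \<and> (u = r \<or> v = r)" for u v
    by (cases "u = r"; cases "v = r") (auto simp: edge_iff)
qed

text \<open>The root is the second centre and \<open>far\<close> is the leaf set at
  \<open>a\<close>, so the parameter is the degree of \<open>a\<close>.\<close>

lemma double_star_if_far_siblings:
  assumes a: "a \<in> kids" and par_far: "\<And>w. w \<in> far \<Longrightarrow> par w = a"
  shows "is_double_star (card far + 1) E"
proof -
  have par: "par v = (if v \<in> far then a else r)" if "v \<noteq> r" for v
    using that par_far far[of v] by auto
  have notin: "a \<notin> far" "r \<notin> far" "a \<noteq> r" using a far[of a] far[of r] kids[of a] by auto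
  show ?thesis
    unfolding is_double_star_def
  proof (intro exI conjI allI)
    show "a \<noteq> r" "far \<subseteq> UNIV - {a, r}" "card far = card far + 1 - 1" using notin by auto
    fix u v
    show "E u v \<longleftrightarrow>
        ((u = a \<and> v = r) \<or> (u = r \<and> v = a) \<or>
         (u = a \<and> v \<in> far) \<or> (v = a \<and> u \<in> far) \<or>
         (u = r \<and> v \<notin> far \<union> {a, r}) \<or> (v = r \<and> u \<notin> far \<union> {a, r}))"
    proof (cases "u = r"; cases "v = r")
      assume "u \<noteq> r" "v \<noteq> r"
      then have "E u v \<longleftrightarrow> v = (if u \<in> far then a else r) \<or> u = (if v \<in> far then a else r)"
        by (simp add: edge_iff par)
      then show ?thesis using \<open>u \<noteq> r\<close> \<open>v \<noteq> r\<close> notin by auto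
    qed (use notin par in \<open>auto simp: edge_iff split: if_splits\<close>)
  qed
qed

text \<open>The tree consists of a root with \<open>m\<close> leaves and two paths of length 2.
  Eliminating each path from its end expresses \<open>y v1\<close> and \<open>y v2\<close> by
  \<open>y r\<close>; the equation at the root then determines \<open>\<tau>\<close>.\<close>

lemma two_legs_rho:
  fixes p :: real
  assumes w: "far = {w1, w2}" "w1 \<noteq> w2" and v: "par w1 \<in> kids" "par w2 \<in> kids" "par w1 \<noteq> par w2"
    and card: "card kids = m + 2"
  defines "\<tau> \<equiv> (sombor_rho p E)^2" and "F \<equiv> pnorm p 2 1" and "D \<equiv> pnorm p (real m + 2) 2"
    and "B \<equiv> pnorm p (real m + 2) 1"
  assumes pos: "\<tau> > F^2"
  shows "(\<tau> - F^2) * (\<tau> - real m * B^2) = 2 * D^2 * \<tau>"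
proof -
  define \<rho> where "\<rho> = sombor_rho p E"
  define v1 v2 where "v1 = par w1" and "v2 = par w2"
  obtain y where nz: "\<exists>i. y i \<noteq> 0" and ev: "\<And>i. \<rho> * y i = (\<Sum>j | E i j. sombor_weight p E i j * y j)"
    using sombor_rho_eigenvector[OF simple] unfolding \<rho>_def by blast
  have pw: "par w1 = v1" "par w2 = v2" "par v1 = r" "par v2 = r"
    using v by (simp_all add: v1_def v2_def kids)
  have k: "v1 \<in> kids" "v2 \<in> kids" "v1 \<noteq> v2" using v by (simp_all add: v1_def v2_def)
  have wf: "w1 \<in> far" "w2 \<in> far" using w by simp_all
  have dist: "w1 \<noteq> r" "w2 \<noteq> r" "v1 \<noteq> r" "v2 \<noteq> r" "w1 \<notin> kids" "w2 \<notin> kids" "r \<notin> kids" "r \<notin> far"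
    "v1 \<noteq> w1" "v1 \<noteq> w2" "v2 \<noteq> w1" "v2 \<noteq> w2"
    using wf k by (auto simp: kids far)
  have par_other: "par x = r" if "x \<noteq> r" "x \<noteq> w1" "x \<noteq> w2" for x
    using that far[of x] w by auto
  define N where "N = kids - {v1, v2}"
  have N: "card N = m" using card k by (simp add: N_def card_Diff_subset)
  have nb: "{u. E r u} = insert v1 (insert v2 N)"
    using k by (auto simp: N_def kids_def)
  have ch: "{u. u \<noteq> r \<and> par u = x} = (if x = v1 then {w1} else if x = v2 then {w2} else {})" if "x \<noteq> r" for x
  proof -
    show ?thesis
    proof (rule set_eqI)
      fix u
      consider "u = r" | "u = w1" | "u = w2" | "u \<noteq> r" "u \<noteq> w1" "u \<noteq> w2" by blast
      then show "u \<in> {u. u \<noteq> r \<and> par u = x} \<longleftrightarrow> u \<in> (if x = v1 then {w1} else if x = v2 then {w2} else {})"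
        using that dist w(2) k(3) pw par_other[of u] by cases auto
    qed
  qed
  have nv1: "{u. E v1 u} = {r, w1}" and nv2: "{u. E v2 u} = {r, w2}"
    and nw1: "{u. E w1 u} = {v1}" and nw2: "{u. E w2 u} = {v2}"
    using dist k(3) by (simp_all add: nbrs_nonroot ch pw)
  have nN: "{u. E x u} = {r}" if "x \<in> N" for x
    using that by (auto simp: N_def kids nbrs_nonroot ch)
  have dN: "v1 \<notin> N" "v2 \<notin> N" by (simp_all add: N_def)
  have deg: "degree E r = m + 2" "degree E v1 = 2" "degree E v2 = 2" "degree E w1 = 1" "degree E w2 = 1"
    "x \<in> N \<Longrightarrow> degree E x = 1" for x
    using card dist by (simp_all add: degree_def nv1 nv2 nw1 nw2 nN flip: kids_def)
  have W: "sombor_weight p E r v1 = D" "sombor_weight p E r v2 = D" "sombor_weight p E v1 r = D"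
    "sombor_weight p E v2 r = D" "sombor_weight p E v1 w1 = F" "sombor_weight p E v2 w2 = F"
    "sombor_weight p E w1 v1 = F" "sombor_weight p E w2 v2 = F"
    "x \<in> N \<Longrightarrow> sombor_weight p E r x = B" "x \<in> N \<Longrightarrow> sombor_weight p E x r = B" for x
    by (simp_all add: sombor_weight_def deg D_def F_def B_def pnorm_commute[of p 1]
        pnorm_commute[of p 2 "real m + 2"] add.commute)
  have leaf: "\<rho> * y x = B * y r" if "x \<in> N" for x using ev[of x] that by (simp add: nN W)
  have ew: "\<rho> * y w1 = F * y v1" "\<rho> * y w2 = F * y v2" using ev[of w1] ev[of w2] by (simp_all add: nw1 nw2 W)
  have e: "\<rho> * y v1 = D * y r + F * y w1" "\<rho> * y v2 = D * y r + F * y w2"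
    using ev[of v1] ev[of v2] dist by (simp_all add: nv1 nv2 W)
  have er: "\<rho> * y r = D * y v1 + D * y v2 + (\<Sum>x\<in>N. B * y x)"
    using ev[of r] k(3) dN by (simp add: nb W)
  have \<tau>: "\<tau> = \<rho> * \<rho>" by (simp add: \<tau>_def \<rho>_def power2_eq_square)
  have "\<tau> > 0" using pos zero_le_power2[of F] by linarith
  then have \<rho>0: "\<rho> \<noteq> 0" by (auto simp: \<tau>)
  have sub: "(\<tau> - F^2) * y v = D * \<rho> * y r"
    if "\<rho> * y v = D * y r + F * y w" "\<rho> * y w = F * y v" for v w
  proof -
    have "\<tau> * y v = \<rho> * (\<rho> * y v)" by (simp add: \<tau>)
    also have "\<dots> = D * \<rho> * y r + F * (\<rho> * y w)" by (simp add: that(1) algebra_simps)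
    also have "\<dots> = D * \<rho> * y r + F^2 * y v" by (simp add: that(2) power2_eq_square)
    finally show ?thesis by (simp add: algebra_simps)
  qed
  note s1 = sub[OF e(1) ew(1)] and s2 = sub[OF e(2) ew(2)]
  have "\<tau> * y r = \<rho> * (\<rho> * y r)" by (simp add: \<tau>)
  also have "\<dots> = D * \<rho> * (y v1 + y v2) + (\<Sum>x\<in>N. B * (\<rho> * y x))"
    unfolding er by (simp add: algebra_simps sum_distrib_left)
  also have "(\<Sum>x\<in>N. B * (\<rho> * y x)) = real m * B^2 * y r"
    using leaf by (simp add: N power2_eq_square)
  finally have "(\<tau> - real m * B^2) * y r = D * \<rho> * (y v1 + y v2)" by (simp add: algebra_simps)
  then have "(\<tau> - F^2) * ((\<tau> - real m * B^2) * y r) = D * \<rho> * ((\<tau> - F^2) * y v1 + (\<tau> - F^2) * y v2)"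
    by (simp add: algebra_simps)
  also have "\<dots> = 2 * D^2 * \<tau> * y r" unfolding s1 s2 by (simp add: \<tau> power2_eq_square algebra_simps)
  finally have main: "(\<tau> - F^2) * (\<tau> - real m * B^2) * y r = 2 * D^2 * \<tau> * y r" by (simp add: algebra_simps)
  \<comment> \<open>With \<open>\<tau> > F^2\<close>, a zero at the root would spread along both
    paths and to all leaves.\<close>
  have "y r \<noteq> 0"
  proof
    assume yr: "y r = 0"
    then have yv: "y v1 = 0" "y v2 = 0" using s1 s2 pos by auto
    then have yw: "y w1 = 0" "y w2 = 0" using ew \<rho>0 by auto
    have "y i = 0" for i
    proof (cases "i \<in> N")
      case True
      then show ?thesis using leaf[of i] yr \<rho>0 by simp
    next
      case False
      then have "i = r \<or> i = v1 \<or> i = v2 \<or> i = w1 \<or> i = w2"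
        using par_other[of i] kids[of i] by (auto simp: N_def)
      then show ?thesis using yr yv yw by auto
    qed
    with nz show False by blast
  qed
  with main show ?thesis by (simp only: mult_right_cancel simp_thms)
qed

text \<open>Elimination from the end of the path \<open>r\<close>, \<open>v1\<close>,
  \<open>w1\<close>, \<open>w2\<close>, with weights \<open>D\<close>, \<open>G\<close>,
  \<open>F\<close> in this order; the remaining \<open>m\<close> neighbours of the root are
  leaves.\<close>

lemma long_leg_rho:
  fixes p :: real
  assumes w: "far = {w1, w2}" "w1 \<noteq> w2" and v: "par w1 \<in> kids" "par w2 = w1"
    and card: "card kids = m + 1"
  defines "\<tau> \<equiv> (sombor_rho p E)^2" and "F \<equiv> pnorm p 2 1" and "G \<equiv> pnorm p 2 2"
    and "D \<equiv> pnorm p (real m + 1) 2" and "B \<equiv> pnorm p (real m + 1) 1"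
  assumes pos: "\<tau> > F^2 + G^2"
  shows "(\<tau> - real m * B^2) * (\<tau> - F^2 - G^2) = D^2 * (\<tau> - F^2)"
proof -
  define \<rho> where "\<rho> = sombor_rho p E"
  define v1 where "v1 = par w1"
  obtain y where nz: "\<exists>i. y i \<noteq> 0" and ev: "\<And>i. \<rho> * y i = (\<Sum>j | E i j. sombor_weight p E i j * y j)"
    using sombor_rho_eigenvector[OF simple] unfolding \<rho>_def by blast
  have pw: "par w1 = v1" "par w2 = w1" "par v1 = r"
    using v by (simp_all add: v1_def kids)
  have k: "v1 \<in> kids" using v by (simp_all add: v1_def)
  have wf: "w1 \<in> far" "w2 \<in> far" using w by simp_all
  have dist: "w1 \<noteq> r" "w2 \<noteq> r" "v1 \<noteq> r" "w1 \<notin> kids" "w2 \<notin> kids" "r \<notin> kids" "r \<notin> far"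
    "v1 \<noteq> w1" "v1 \<noteq> w2"
    using wf k by (auto simp: kids far)
  have par_other: "par x = r" if "x \<noteq> r" "x \<noteq> w1" "x \<noteq> w2" for x
    using that far[of x] w by auto
  define N where "N = kids - {v1}"
  have N: "card N = m" using card k by (simp add: N_def card_Diff_subset)
  have nb: "{u. E r u} = insert v1 N"
    using k by (auto simp: N_def kids_def)
  have ch: "{u. u \<noteq> r \<and> par u = x} = (if x = v1 then {w1} else if x = w1 then {w2} else {})" if "x \<noteq> r" for x
  proof -
    show ?thesis
    proof (rule set_eqI)
      fix u
      consider "u = r" | "u = w1" | "u = w2" | "u \<noteq> r" "u \<noteq> w1" "u \<noteq> w2" by blast
      then show "u \<in> {u. u \<noteq> r \<and> par u = x} \<longleftrightarrow> u \<in> (if x = v1 then {w1} else if x = w1 then {w2} else {})"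
        using that dist w(2) pw par_other[of u] by cases auto
    qed
  qed
  have nv1: "{u. E v1 u} = {r, w1}" and nw1: "{u. E w1 u} = {v1, w2}" and nw2: "{u. E w2 u} = {w1}"
    using dist w(2) by (simp_all add: nbrs_nonroot ch pw)
  have nN: "{u. E x u} = {r}" if "x \<in> N" for x
  proof -
    have "x \<noteq> w1" using that dist by (auto simp: N_def)
    then show ?thesis using that by (auto simp: N_def kids nbrs_nonroot ch)
  qed
  have dN: "v1 \<notin> N" by (simp_all add: N_def)
  have deg: "degree E r = m + 1" "degree E v1 = 2" "degree E w1 = 2" "degree E w2 = 1"
    "x \<in> N \<Longrightarrow> degree E x = 1" for x
    using card dist by (simp_all add: degree_def nv1 nw1 nw2 nN flip: kids_def)
  have W: "sombor_weight p E r v1 = D" "sombor_weight p E v1 r = D"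
    "sombor_weight p E v1 w1 = G" "sombor_weight p E w1 v1 = G"
    "sombor_weight p E w1 w2 = F" "sombor_weight p E w2 w1 = F"
    "x \<in> N \<Longrightarrow> sombor_weight p E r x = B" "x \<in> N \<Longrightarrow> sombor_weight p E x r = B" for x
    by (simp_all add: sombor_weight_def deg D_def F_def G_def B_def pnorm_commute[of p 1]
        pnorm_commute[of p 2 "1 + real m"] add.commute)
  have leaf: "\<rho> * y x = B * y r" if "x \<in> N" for x using ev[of x] that by (simp add: nN W)
  have e2: "\<rho> * y w2 = F * y w1" using ev[of w2] by (simp add: nw2 W)
  have e1: "\<rho> * y w1 = G * y v1 + F * y w2" using ev[of w1] dist by (simp add: nw1 W)
  have ev1: "\<rho> * y v1 = D * y r + G * y w1" using ev[of v1] dist by (simp add: nv1 W)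
  have er: "\<rho> * y r = D * y v1 + (\<Sum>x\<in>N. B * y x)"
    using ev[of r] dN by (simp add: nb W)
  have \<tau>: "\<tau> = \<rho> * \<rho>" by (simp add: \<tau>_def \<rho>_def power2_eq_square)
  have \<tau>0: "\<tau> > 0" "\<tau> > F^2" using pos zero_le_power2[of F] zero_le_power2[of G] by linarith+
  then have \<rho>0: "\<rho> \<noteq> 0" by (auto simp: \<tau>)
  have "\<rho> * (\<rho> * y w1) = \<rho> * (G * y v1) + F * (\<rho> * y w2)"
    unfolding e1 by (simp add: algebra_simps)
  then have s1: "(\<tau> - F^2) * y w1 = G * \<rho> * y v1"
    unfolding e2 by (simp add: \<tau> power2_eq_square algebra_simps)
  have "(\<tau> - F^2) * (\<rho> * (\<rho> * y v1)) = (\<tau> - F^2) * (D * \<rho> * y r) + G * \<rho> * ((\<tau> - F^2) * y w1)"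
    unfolding ev1 by (simp add: algebra_simps)
  then have "\<tau> * ((\<tau> - F^2 - G^2) * y v1) = (\<tau> - F^2) * (D * \<rho> * y r)"
    unfolding s1 by (simp add: \<tau> power2_eq_square algebra_simps)
  then have s2: "\<rho> * ((\<tau> - F^2 - G^2) * y v1) = (\<tau> - F^2) * D * y r"
    using \<rho>0 by (simp add: \<tau>)
  have "\<tau> * y r = \<rho> * (\<rho> * y r)" by (simp add: \<tau>)
  also have "\<dots> = D * \<rho> * y v1 + (\<Sum>x\<in>N. B * (\<rho> * y x))"
    unfolding er by (simp add: algebra_simps sum_distrib_left)
  also have "(\<Sum>x\<in>N. B * (\<rho> * y x)) = real m * B^2 * y r"
    using leaf by (simp add: N power2_eq_square)
  finally have "(\<tau> - real m * B^2) * y r = D * \<rho> * y v1" by (simp add: algebra_simps)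
  then have "(\<tau> - F^2 - G^2) * ((\<tau> - real m * B^2) * y r) = D * (\<rho> * ((\<tau> - F^2 - G^2) * y v1))"
    by (simp add: algebra_simps)
  also have "\<dots> = D^2 * (\<tau> - F^2) * y r" unfolding s2 by (simp add: power2_eq_square)
  finally have main: "(\<tau> - real m * B^2) * (\<tau> - F^2 - G^2) * y r = D^2 * (\<tau> - F^2) * y r"
    by (simp only: mult_ac)
  have "y r \<noteq> 0"
  proof
    assume yr: "y r = 0"
    then have yv: "y v1 = 0" using s2 pos \<rho>0 by auto
    then have yw: "y w1 = 0" using s1 \<tau>0 by auto
    then have yw2: "y w2 = 0" using e2 \<rho>0 by auto
    have "y i = 0" for i
    proof (cases "i \<in> N")
      case True
      then show ?thesis using leaf[of i] yr \<rho>0 by simp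
    next
      case False
      then have "i = r \<or> i = v1 \<or> i = w1 \<or> i = w2"
        using par_other[of i] kids[of i] by (auto simp: N_def)
      then show ?thesis using yr yv yw yw2 by auto
    qed
    with nz show False by blast
  qed
  then show ?thesis using main by (simp only: mult_right_cancel simp_thms)
qed

end

text \<open>Rooted at a vertex of maximum degree, the tree has either degree at most
  \<open>n - 4\<close> there or at most two far vertices. In the second case the excluded trees and
  the two exceptional shapes exhaust the possibilities.\<close>

lemma sombor_rho_tree_less_double_star_3:
  fixes T S3 :: "'n::finite \<Rightarrow> 'n \<Rightarrow> bool"
  assumes p: "p \<ge> 1" and n: "CARD('n) \<ge> 6" and S3: "is_double_star 3 S3" and tree: "is_tree T"
    and not: "\<not> is_star T" "\<not> is_double_star 2 T" "\<not> is_double_star 3 T"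
  shows "sombor_rho p T < sombor_rho p S3"
proof -
  obtain a b L K where "double_star S3 a b L K" and cL: "card L = 3 - 1"
    using is_double_star_obtain[OF S3] .
  then interpret S: double_star S3 a b L K by simp
  define k where "k = real CARD('n) - 3"
  define A B C where "A = pnorm p 3 1" and "B = pnorm p k 1" and "C = pnorm p k 3"
  define t where "t = (sombor_rho p S3)^2"
  have t: "t > 2 * A^2" "t = (k - 1) * B^2 + C^2 * t / (t - 2 * A^2)"
    "(k - 1) * B^2 + C^2 + 2 / k * A^2 \<le> t"
    using S.double_star_3_rho_sq[OF p n] cL by (simp_all add: A_def B_def C_def k_def t_def)
  have k3: "k \<ge> 3" using n by (simp add: k_def)
  have pos: "A > 0" "B > 0" "C > 0" unfolding A_def B_def C_def using k3 by (auto intro!: pnorm_pos[OF p])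
  have "A \<le> B" "B \<le> C" unfolding A_def B_def C_def using k3 by (auto intro!: pnorm_mono[OF p])
  then have AB: "A^2 \<le> B^2" "B^2 \<le> C^2" using pos by (auto intro!: power_mono)
  have sq: "A^2 > 0" "B^2 > 0" "C^2 > 0" using pos by simp_all
  have t': "(k - 1) * B^2 + C^2 \<le> t" using t(3) sq k3 by (smt (verit) divide_nonneg_nonneg mult_nonneg_nonneg)
  have "2 * B^2 \<le> (k - 1) * B^2" using k3 by (intro mult_right_mono) auto
  then have t3: "3 * B^2 \<le> t" using t' AB by linarith
  define F where "F = pnorm p 2 1"
  have "F \<le> A" unfolding F_def A_def by (auto intro!: pnorm_mono[OF p])
  then have FA: "F^2 \<le> A^2" by (intro power_mono) (auto simp: F_def)
  obtain r where max: "\<And>v. degree T v \<le> degree T r"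
  proof -
    have "Max (range (degree T)) \<in> range (degree T)" by (intro Max_in) auto
    then obtain r where "degree T r = Max (range (degree T))" by (metis imageE)
    then show thesis by (intro that[of r]) simp
  qed
  obtain par dep where "rooted_tree T r par dep" using tree_obtain_root[OF tree] .
  then interpret T: rooted_tree T r par dep .
  have dr: "degree T r \<le> CARD('n) - 1" by (rule T.degree_root_less)
  have sqless: "(sombor_rho p T)^2 < t"
  proof (cases "degree T r + 4 \<le> CARD('n)")
    case True
    then show ?thesis
      using T.sombor_rho_sq_less_low_degree[OF p n True max] t(3) by (simp add: A_def B_def C_def k_def)
  next
    case False
    then have "card T.far \<le> 2" using T.card_far dr n by linarith
    then consider "card T.far = 0" | "card T.far = 1" | "card T.far = 2" by linarith
    then show ?thesis
    proof cases
      case 1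
      then show ?thesis using T.star_if_far_empty not by simp
    next
      case 2
      then obtain w where w: "T.far = {w}" by (auto simp: card_1_singleton_iff)
      then have "par w \<noteq> r" "w \<noteq> r" using T.far[of w] by auto
      then have "par w \<in> T.kids" using w T.far[of "par w"] T.kids[of "par w"] T.par_neq[of w] by auto
      then have "is_double_star (card T.far + 1) T"
        by (rule T.double_star_if_far_siblings) (simp add: w)
      then show ?thesis using not 2 by (simp add: numeral_2_eq_2)
    next
      case 3
      then obtain w1 w2 where w: "T.far = {w1, w2}" "w1 \<noteq> w2" by (auto simp: card_2_iff)
      have cf: "card T.far + 1 = 3" using 3 by simp
      have ck: "real (card T.kids) = k"
        using 3 T.card_far T.card_kids dr n by (simp add: k_def)
      have wr: "par w1 \<noteq> r" "w1 \<noteq> r" "par w2 \<noteq> r" "w2 \<noteq> r"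
        using T.far[of w1] T.far[of w2] w by auto
      have pw: "par w \<in> T.kids \<or> par w = w1 \<or> par w = w2" if "w \<in> {w1, w2}" for w
        using that T.far[of "par w"] T.kids[of "par w"] w wr by auto
      \<comment> \<open>Stated for arbitrary names, as either far vertex may be the end of the long
        leg.\<close>
      have long: "(sombor_rho p T)^2 < t" if w': "T.far = {x, y}" "x \<noteq> y" and "par x \<in> T.kids" "par y = x" for x y
      proof (rule ccontr)
        assume not_less: "\<not> (sombor_rho p T)^2 < t"
        define G where "G = pnorm p 2 2"
        define D where "D = pnorm p k 2"
        have "G \<le> 1 * A" unfolding G_def A_def by (intro pnorm_majorize[OF p]) auto
        then have GA: "G^2 \<le> A^2" by (intro power_mono) (auto simp: G_def)
        have "D \<le> C" unfolding D_def C_def using k3 by (auto intro!: pnorm_mono[OF p])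
        then have DC: "D^2 \<le> C^2" by (intro power_mono) (auto simp: D_def)
        have D0: "D > 0" unfolding D_def using k3 by (auto intro!: pnorm_pos[OF p])
        have big: "F^2 + G^2 < (sombor_rho p T)^2" using FA GA AB t3 sq not_less by linarith
        obtain m where m: "card T.kids = m + 1" using ck k3 by (cases "card T.kids") auto
        then have mk: "real m = k - 1" using ck by simp
        have "(sombor_rho p T)^2 < t"
          using T.long_leg_rho[OF that m, of p] big
          by (intro no_large_root_long_leg[OF k3 pos D0 GA order_trans[OF FA AB(1)] AB(1) DC t(1,2) t'])
            (auto simp: mk D_def G_def F_def B_def)
        with not_less show False ..
      qed
      show ?thesis
      proof (cases "par w1 \<in> T.kids \<and> par w2 \<in> T.kids")
        case True
        show ?thesis
        proof (cases "par w1 = par w2")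
          assume "par w1 = par w2"
          then have "is_double_star (card T.far + 1) T"
            using True w by (intro T.double_star_if_far_siblings[of "par w1"]) auto
          then show ?thesis using not cf by simp
        next
          assume ne: "par w1 \<noteq> par w2"
          show ?thesis
          proof (rule ccontr)
            assume not_less: "\<not> (sombor_rho p T)^2 < t"
            define D where "D = pnorm p k 2"
            \<comment> \<open>The pair \<open>(k, 2)\<close> is the midpoint of
              \<open>(k, 1)\<close> and \<open>(k, 3)\<close>.\<close>
            have "2 * D \<le> B + C"
              using pnorm_triangle[OF p, of k 1 k 3] pnorm_scale[OF p, of 2 k 2] k3
              by (simp add: D_def B_def C_def)
            then have "(2 * D)^2 \<le> (B + C)^2" by (intro power_mono) (auto simp: D_def)
            also have "\<dots> \<le> 2 * (B^2 + C^2)"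
              using zero_le_power2[of "B - C"] by (simp add: power2_sum power2_diff)
            finally have DBC: "2 * D^2 \<le> B^2 + C^2" by (simp add: power_mult_distrib)
            have big: "F^2 < (sombor_rho p T)^2" using FA AB t3 sq not_less by linarith
            have "card T.kids \<ge> 2" using ck k3 by linarith
            then obtain m where m: "card T.kids = m + 2" by (metis le_iff_add add.commute)
            then have mk: "real m = k - 2" using ck by simp
            have "(sombor_rho p T)^2 < t"
              using T.two_legs_rho[OF w _ _ ne m, of p] big True
              by (intro no_large_root_two_legs[OF k3 pos FA AB(2) DBC t(1,2)])
                (auto simp: mk D_def F_def B_def)
            with not_less show False ..
          qed
        qed
      next
        case False
        have "par w1 \<noteq> w1" "par w2 \<noteq> w2" using T.par_neq wr by auto
        \<comment> \<open>Depth forbids two far vertices from being each other's parent, so exactly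
          one of them hangs below the other.\<close>
        moreover have "\<not> (par w1 = w2 \<and> par w2 = w1)"
          using T.dep_par[of w1] T.dep_par[of w2] wr by auto
        ultimately consider "par w1 \<in> T.kids" "par w2 = w1" | "par w2 \<in> T.kids" "par w1 = w2"
          using False pw[of w1] pw[of w2] by auto
        then show ?thesis
        proof cases
          case 1
          then show ?thesis using long[OF w] by blast
        next
          case 2
          then show ?thesis using long[of w2 w1] w by (auto simp: insert_commute)
        qed
      qed
    qed
  qed
  show ?thesis
    by (rule power_less_imp_less_base[OF sqless[unfolded t_def]]) (rule S.rho_nonneg)
qed

theorem theorem3p2:
  fixes p :: real
    and Sn S2 S3 :: "'n::finite \<Rightarrow> 'n \<Rightarrow> bool"
  assumes "p \<ge> 1"
    and "CARD('n) \<ge> 6"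
    and "is_star Sn"
    and "is_double_star 2 S2"
    and "is_double_star 3 S3"
  shows "(\<forall>T :: 'n \<Rightarrow> 'n \<Rightarrow> bool. is_tree T \<and> \<not> is_star T \<and> \<not> is_double_star 2 T \<and>
            \<not> is_double_star 3 T \<longrightarrow> sombor_rho p T < sombor_rho p S3)
         \<and> sombor_rho p S3 < sombor_rho p S2
         \<and> sombor_rho p S2 < sombor_rho p Sn"
proof (intro conjI allI impI)
  show "sombor_rho p T < sombor_rho p S3"
    if "is_tree T \<and> \<not> is_star T \<and> \<not> is_double_star 2 T \<and> \<not> is_double_star 3 T"
    for T :: "'n \<Rightarrow> 'n \<Rightarrow> bool"
    using sombor_rho_tree_less_double_star_3[OF assms(1,2,5)] that by blast
  show "sombor_rho p S3 < sombor_rho p S2"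
    using assms by (intro sombor_rho_double_star_3_less_2)
  show "sombor_rho p S2 < sombor_rho p Sn"
    using assms by (intro sombor_rho_double_star_less_star) auto
qed

end
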